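(* Let $N$ be a multivariate counting process on $\mathbb{R}_+\times\mathcal I\times\mathcal J$ with stochastic intensity $$\lambda_t(i,j)=\bar\lambda_t(i)\,\exp\{\beta_0^{T}x_t(i,j)\}\,1\{j\in\mathcal J_t(i)\},$$ with true parameter vector $\beta_0\in\mathbb{R}^p$. Let $t_n=\sup\{t:N_t<n\}$ be the sequence of interaction times, and let $$\log \mathit{PL}_t(\beta)=\sum_{t_m\le t}\Big\{\beta^{T}x_{t_m}(i_m,j_m)-\log\Big[\sum_{j\in\mathcal J_{t_m}(i_m)}\exp\{\beta^{T}x_{t_m}(i_m,j)\}\Big]\Big\}$$ be the log partial likelihood, with gradient $U_t(\beta)=\nabla[\log \mathit{PL}_t(\beta)]$. Assume that for $\beta$ in a neighborhood of $\beta_0$, $$-\tfrac1n\nabla^2[\log \mathit{PL}_{t_n}(\beta)]\xrightarrow{P}\Sigma_1(\beta),$$ where $\Sigma_1(\cdot)$ is locally Lipschitz and has smallest eigenvalue bounded away from zero. Assume also that, as $n\to\infty$, $n^{-1/2}U_{t_{\lfloor\alpha n\rfloor}}(\beta_0)$, as a process in $\alpha$, converges weakly to a Gaussian process on $[0,1]$ with covariance function $\Sigma_\alpha(\beta_0)$ (whose value at $\alpha=1$ is $\Sigma_1(\beta_0)$). If $\hat\beta_n$ maximizes $\log \mathit{PL}_{t_n}(\cdot)$, then as $n\to\infty$: (a) $\hat\beta_n$ is a consistent estimator of $\beta_0$; (b) $\sqrt n\,(\hat\beta_n-\beta_0)$ converges weakly to a mean-zero Gaussian random variable with covariance $[\S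igma_1(\beta_0)]^{-1}$.
   Context: Setting. $\mathcal I$ is a set of senders and $\mathcal J$ a (not necessarily disjoint) set of receivers. $N_t(i,j)$ counts the directed interactions $i\to j$ in $[0,t]$, $N_0(i,j)=0$, and $N$ is adapted to a filtration $\{\mathcal F_t\}_{t\ge0}$ satisfying the usual conditions; no two interactions happen simultaneously, and each interaction has a single receiver. That $N$ has stochastic intensity $\lambda$ means that $N_t(i,j)-\int_0^t\lambda_s(i,j)\,ds$ is an $\mathcal F_t$-local martingale for each $(i,j)$. For each $i$, $\bar\lambda_t(i)$ is a non-negative predictable process and $\mathcal J_t(i)$ is a predictable finite subset of $\mathcal J$. For each $(i,j)$, $x_t(i,j)$ is a predictable, locally bounded process with values in $\mathbb{R}^p$. $N_t=\sum_{i\in\mathcal I}\sum_{j\in\mathcal J}N_t(i,j)$. The observed interactions are $(t_1,i_1,j_1),(t_2,i_2,j_2),\dots$ (time, sender, receiver). $\xrightarrow{P}$ is convergence in probability. "Gaussian process on $[0,1]$ with covariance function $\Sigma_\alpha(\beta_0)$" means a mean-zero Gaussian process with independent increments whose covariance matrix at time $\alpha$ is $\Sigma_\alpha(\beta_0)$. Lipschitz continuity of matrices is with respect to the spectral norm.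
   Formalization: The convergence in probability of the normalized Hessian to Σ_1(β) is assumed uniformly over β in a neighborhood of β_0 (in spectral norm); with convergence only at each fixed β, part (b) can fail when covariates are unbounded. *)

theory Defs
  imports "HOL-Probability.Probability"
begin

section \<open>Filtrations, predictability and local martingales\<close>

text \<open>
  Time is \<open>[0, \<infinity>)\<close>, embedded in type \<^typ>\<open>real\<close>.  Nothing below depends on \<open>F t\<close> for
  \<open>t < 0\<close>; any filtration on \<open>[0, \<infinity>)\<close> extends by \<open>F t = F 0\<close>.
\<close>

definition usual_conditions :: "'a measure \<Rightarrow> (real \<Rightarrow> 'a measure) \<Rightarrow> bool" where
  "usual_conditions M F \<longleftrightarrow>
     filtration (space M) F \<and>
     (\<forall>t. subalgebra M (F t)) \<and>
     (\<forall>t\<ge>0. sets (F t) = (\<Inter>s\<in>{t<..}. sets (F s))) \<and>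
     complete_measure M \<and> null_sets M \<subseteq> sets (F 0)"

definition predictable_sigma :: "'a measure \<Rightarrow> (real \<Rightarrow> 'a measure) \<Rightarrow> (real \<times> 'a) measure" where
  "predictable_sigma M F = sigma ({0..} \<times> space M)
     ({{0} \<times> A | A. A \<in> sets (F 0)} \<union>
      {{s<..t} \<times> A | s t A. 0 \<le> s \<and> s < t \<and> A \<in> sets (F s)})"

definition predictable ::
  "'a measure \<Rightarrow> (real \<Rightarrow> 'a measure) \<Rightarrow> (real \<Rightarrow> 'a \<Rightarrow> 'b::topological_space) \<Rightarrow> bool" where
  "predictable M F X \<longleftrightarrow> (\<lambda>(t, \<omega>). X t \<omega>) \<in> borel_measurable (predictable_sigma M F)"

text \<open>
  Localizing sequences consist of finite stopping times.  This is no restriction: an extended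
  sequence \<open>\<tau> k\<close> may be replaced by \<open>min (\<tau> k) k\<close>.
\<close>

definition localizing :: "'a measure \<Rightarrow> (real \<Rightarrow> 'a measure) \<Rightarrow> (nat \<Rightarrow> 'a \<Rightarrow> real) \<Rightarrow> bool" where
  "localizing M F \<tau> \<longleftrightarrow>
     (\<forall>k. stopping_time F (\<tau> k) \<and> (\<forall>\<omega>\<in>space M. 0 \<le> \<tau> k \<omega>)) \<and>
     (AE \<omega> in M. incseq (\<lambda>k. \<tau> k \<omega>) \<and> filterlim (\<lambda>k. \<tau> k \<omega>) at_top sequentially)"

definition is_martingale ::
  "'a measure \<Rightarrow> (real \<Rightarrow> 'a measure) \<Rightarrow> (real \<Rightarrow> 'a \<Rightarrow> real) \<Rightarrow> bool" where
  "is_martingale M F X \<longleftrightarrow>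
     (\<forall>t\<ge>0. X t \<in> borel_measurable (F t) \<and> integrable M (X t)) \<and>
     (\<forall>s t. 0 \<le> s \<longrightarrow> s \<le> t \<longrightarrow> (AE \<omega> in M. real_cond_exp M (F s) (X t) \<omega> = X s \<omega>))"

definition local_martingale ::
  "'a measure \<Rightarrow> (real \<Rightarrow> 'a measure) \<Rightarrow> (real \<Rightarrow> 'a \<Rightarrow> real) \<Rightarrow> bool" where
  "local_martingale M F X \<longleftrightarrow>
     (\<exists>\<tau>. localizing M F \<tau> \<and> (\<forall>k. is_martingale M F (\<lambda>t \<omega>. X (min t (\<tau> k \<omega>)) \<omega>)))"

text \<open>As usual, the stopped process is only bounded on \<open>{\<tau> k > 0}\<close>.\<close>

definition locally_bounded ::
  "'a measure \<Rightarrow> (real \<Rightarrow> 'a measure) \<Rightarrow> (real \<Rightarrow> 'a \<Rightarrow> 'b::real_normed_vector) \<Rightarrow> bool" where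
  "locally_bounded M F X \<longleftrightarrow>
     (\<exists>\<tau>. localizing M F \<tau> \<and>
       (\<forall>k. \<exists>c. \<forall>\<omega>\<in>space M. 0 < \<tau> k \<omega> \<longrightarrow> (\<forall>t. 0 \<le> t \<and> t \<le> \<tau> k \<omega> \<longrightarrow> norm (X t \<omega>) \<le> c)))"


section \<open>Multivariate counting processes on \<open>I \<times> J\<close>\<close>

text \<open>
  \<open>N t i j \<omega>\<close> counts the interactions \<open>i \<rightarrow> j\<close> in \<open>[0, t]\<close>.  The index sets may be infinite; the
  total is a sum over the pairs that have interacted by time \<open>t\<close>, which are required to be
  finite in number below.
\<close>

definition total_count ::
  "'v set \<Rightarrow> 'v set \<Rightarrow> (real \<Rightarrow> 'v \<Rightarrow> 'v \<Rightarrow> 'a \<Rightarrow> nat) \<Rightarrow> real \<Rightarrow> 'a \<Rightarrow> nat" where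
  "total_count I J N t \<omega> = (\<Sum>(i, j) | (i, j) \<in> I \<times> J \<and> N t i j \<omega> \<noteq> 0. N t i j \<omega>)"

text \<open>
  The last clause says that the total count has jumps of size at most one: every component has
  unit jumps, and no two components jump at the same time.
\<close>

definition counting_process ::
  "'a measure \<Rightarrow> (real \<Rightarrow> 'a measure) \<Rightarrow> 'v set \<Rightarrow> 'v set \<Rightarrow>
   (real \<Rightarrow> 'v \<Rightarrow> 'v \<Rightarrow> 'a \<Rightarrow> nat) \<Rightarrow> bool" where
  "counting_process M F I J N \<longleftrightarrow>
     (\<forall>i\<in>I. \<forall>j\<in>J. \<forall>t\<ge>0. (\<lambda>\<omega>. real (N t i j \<omega>)) \<in> borel_measurable (F t)) \<and>
     (\<forall>\<omega>\<in>space M.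
        (\<forall>i\<in>I. \<forall>j\<in>J.
           N 0 i j \<omega> = 0 \<and>
           mono_on {0..} (\<lambda>t. N t i j \<omega>) \<and>
           (\<forall>t\<ge>0. continuous (at_right t) (\<lambda>s. real (N s i j \<omega>)))) \<and>
        (\<forall>t\<ge>0. finite {(i, j). (i, j) \<in> I \<times> J \<and> N t i j \<omega> \<noteq> 0}) \<and>
        (\<forall>t>0. \<exists>s. 0 \<le> s \<and> s < t \<and> total_count I J N t \<omega> \<le> total_count I J N s \<omega> + 1))"

definition has_intensity ::
  "'a measure \<Rightarrow> (real \<Rightarrow> 'a measure) \<Rightarrow> 'v set \<Rightarrow> 'v set \<Rightarrow>
   (real \<Rightarrow> 'v \<Rightarrow> 'v \<Rightarrow> 'a \<Rightarrow> nat) \<Rightarrow> (real \<Rightarrow> 'v \<Rightarrow> 'v \<Rightarrow> 'a \<Rightarrow> real) \<Rightarrow> bool" where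
  "has_intensity M F I J N lam \<longleftrightarrow>
     (\<forall>i\<in>I. \<forall>j\<in>J.
        (AE \<omega> in M. \<forall>t\<ge>0. set_integrable lborel {0..t} (\<lambda>s. lam s i j \<omega>)) \<and>
        local_martingale M F
          (\<lambda>t \<omega>. real (N t i j \<omega>) - (LINT s:{0..t}|lborel. lam s i j \<omega>)))"

text \<open>The value is \<open>\<infinity>\<close> if fewer than \<open>n\<close> interactions ever happen, and \<open>-\<infinity>\<close> for \<open>n = 0\<close>.\<close>

definition event_time ::
  "'v set \<Rightarrow> 'v set \<Rightarrow> (real \<Rightarrow> 'v \<Rightarrow> 'v \<Rightarrow> 'a \<Rightarrow> nat) \<Rightarrow> nat \<Rightarrow> 'a \<Rightarrow> ereal" where
  "event_time I J N n \<omega> = Sup {ereal t | t. 0 \<le> t \<and> total_count I J N t \<omega> < n}"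

text \<open>
  The pair \<open>(i\<^sub>m, j\<^sub>m)\<close> is the one whose count jumps at \<open>t\<^sub>m\<close>; it is unique for a counting process
  whenever \<open>m \<ge> 1\<close> and \<open>t\<^sub>m < \<infinity>\<close>.
\<close>

definition jumps_at :: "(real \<Rightarrow> 'v \<Rightarrow> 'v \<Rightarrow> 'a \<Rightarrow> nat) \<Rightarrow> 'v \<Rightarrow> 'v \<Rightarrow> real \<Rightarrow> 'a \<Rightarrow> bool" where
  "jumps_at N i j t \<omega> \<longleftrightarrow> (\<forall>s. 0 \<le> s \<and> s < t \<longrightarrow> N s i j \<omega> < N t i j \<omega>)"

definition event_pair ::
  "'v set \<Rightarrow> 'v set \<Rightarrow> (real \<Rightarrow> 'v \<Rightarrow> 'v \<Rightarrow> 'a \<Rightarrow> nat) \<Rightarrow> nat \<Rightarrow> 'a \<Rightarrow> 'v \<times> 'v" where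
  "event_pair I J N m \<omega> =
     (THE (i, j). i \<in> I \<and> j \<in> J \<and> jumps_at N i j (real_of_ereal (event_time I J N m \<omega>)) \<omega>)"


section \<open>The log partial likelihood and its derivatives\<close>

text \<open>\<open>R t i \<omega>\<close> is the set of receivers available to sender \<open>i\<close> at time \<open>t\<close>.\<close>

definition log_PL ::
  "'v set \<Rightarrow> 'v set \<Rightarrow> (real \<Rightarrow> 'v \<Rightarrow> 'v \<Rightarrow> 'a \<Rightarrow> nat) \<Rightarrow>
   (real \<Rightarrow> 'v \<Rightarrow> 'v \<Rightarrow> 'a \<Rightarrow> real ^ 'p) \<Rightarrow> (real \<Rightarrow> 'v \<Rightarrow> 'a \<Rightarrow> 'v set) \<Rightarrow>
   ereal \<Rightarrow> 'a \<Rightarrow> real ^ 'p \<Rightarrow> real" where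
  "log_PL I J N x R t \<omega> \<beta> =
     (\<Sum>m | 1 \<le> m \<and> event_time I J N m \<omega> < \<infinity> \<and> event_time I J N m \<omega> \<le> t.
        let s = real_of_ereal (event_time I J N m \<omega>); (i, j) = event_pair I J N m \<omega>
        in \<beta> \<bullet> x s i j \<omega> - ln (\<Sum>k\<in>R s i \<omega>. exp (\<beta> \<bullet> x s i k \<omega>)))"

definition gradient :: "('b::real_inner \<Rightarrow> real) \<Rightarrow> 'b \<Rightarrow> 'b" where
  "gradient f b = (THE D. GDERIV f b :> D)"

definition hessian :: "(real ^ 'p \<Rightarrow> real) \<Rightarrow> real ^ 'p \<Rightarrow> real ^ 'p ^ 'p" where
  "hessian f b = jacobian (gradient f) (at b)"

definition score ::
  "'v set \<Rightarrow> 'v set \<Rightarrow> (real \<Rightarrow> 'v \<Rightarrow> 'v \<Rightarrow> 'a \<Rightarrow> nat) \<Rightarrow>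
   (real \<Rightarrow> 'v \<Rightarrow> 'v \<Rightarrow> 'a \<Rightarrow> real ^ 'p) \<Rightarrow> (real \<Rightarrow> 'v \<Rightarrow> 'a \<Rightarrow> 'v set) \<Rightarrow>
   ereal \<Rightarrow> 'a \<Rightarrow> real ^ 'p \<Rightarrow> real ^ 'p" where
  "score I J N x R t \<omega> = gradient (log_PL I J N x R t \<omega>)"


section \<open>Matrices\<close>

definition spectral_norm :: "real ^ 'p ^ 'p \<Rightarrow> real" where
  "spectral_norm A = onorm (\<lambda>v. A *v v)"

definition is_eigenvalue :: "real ^ 'p ^ 'p \<Rightarrow> real \<Rightarrow> bool" where
  "is_eigenvalue A k \<longleftrightarrow> (\<exists>v. v \<noteq> 0 \<and> A *v v = k *\<^sub>R v)"

definition locally_lipschitz_on :: "(real ^ 'p) set \<Rightarrow> (real ^ 'p \<Rightarrow> real ^ 'p ^ 'p) \<Rightarrow> bool" where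
  "locally_lipschitz_on V S \<longleftrightarrow>
     (\<forall>\<beta>\<in>V. \<exists>r>0. \<exists>L. \<forall>b\<in>ball \<beta> r \<inter> V. \<forall>b'\<in>ball \<beta> r \<inter> V.
        spectral_norm (S b - S b') \<le> L * dist b b')"


section \<open>Convergence in probability\<close>

definition converges_in_prob ::
  "'a measure \<Rightarrow> (nat \<Rightarrow> 'a \<Rightarrow> 'b::metric_space) \<Rightarrow> 'b \<Rightarrow> bool" where
  "converges_in_prob M X c \<longleftrightarrow>
     (\<forall>n. X n \<in> borel_measurable M) \<and>
     (\<forall>\<epsilon>>0. (\<lambda>n. measure M {\<omega> \<in> space M. \<epsilon> < dist (X n \<omega>) c}) \<longlonglongrightarrow> 0)"

text \<open>
  Convergence in probability of random matrix-valued functions on \<open>V\<close> in the supremum norm.  The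
  event states that the supremum over \<open>V\<close> exceeds \<open>\<epsilon>\<close> (the supremum itself may be infinite).
\<close>

definition converges_in_prob_on ::
  "'a measure \<Rightarrow> (real ^ 'p) set \<Rightarrow> (nat \<Rightarrow> 'a \<Rightarrow> real ^ 'p \<Rightarrow> real ^ 'p ^ 'p) \<Rightarrow>
   (real ^ 'p \<Rightarrow> real ^ 'p ^ 'p) \<Rightarrow> bool" where
  "converges_in_prob_on M V H S \<longleftrightarrow>
     (\<forall>\<epsilon>>0.
        (\<forall>n. {\<omega> \<in> space M. \<exists>\<beta>\<in>V. \<epsilon> < spectral_norm (H n \<omega> \<beta> - S \<beta>)} \<in> sets M) \<and>
        (\<lambda>n. measure M {\<omega> \<in> space M. \<exists>\<beta>\<in>V. \<epsilon> < spectral_norm (H n \<omega> \<beta> - S \<beta>)}) \<longlonglongrightarrow> 0)"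


section \<open>Weak convergence\<close>

definition converges_in_law ::
  "'a measure \<Rightarrow> (nat \<Rightarrow> 'a \<Rightarrow> 'b::metric_space) \<Rightarrow> 'b measure \<Rightarrow> bool" where
  "converges_in_law M X \<mu> \<longleftrightarrow>
     (\<forall>n. X n \<in> borel_measurable M) \<and>
     (\<forall>g :: 'b \<Rightarrow> real. continuous_on UNIV g \<and> bounded (range g) \<longrightarrow>
        (\<lambda>n. \<integral>\<omega>. g (X n \<omega>) \<partial>M) \<longlonglongrightarrow> (\<integral>y. g y \<partial>\<mu>))"

text \<open>
  \<open>D[0,1]\<close> with the Skorokhod J1 topology.  Elements are represented by functions on \<open>\<real>\<close> of which
  only the restriction to \<open>[0,1]\<close> matters: functions that agree on \<open>[0,1]\<close> are topologically
  indistinguishable.  The topology is metrizable, so sequential continuity is continuity.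
\<close>

definition cadlag01 :: "(real \<Rightarrow> 'b::metric_space) set" where
  "cadlag01 = {f. (\<forall>t\<in>{0..<1}. (f \<longlongrightarrow> f t) (at_right t)) \<and>
                  (\<forall>t\<in>{0<..1}. \<exists>l. (f \<longlongrightarrow> l) (at_left t))}"

definition skorokhod_tendsto ::
  "(nat \<Rightarrow> real \<Rightarrow> 'b::metric_space) \<Rightarrow> (real \<Rightarrow> 'b) \<Rightarrow> bool" where
  "skorokhod_tendsto f g \<longleftrightarrow>
     (\<exists>\<tau> :: nat \<Rightarrow> real \<Rightarrow> real.
        (\<forall>n. strict_mono_on {0..1} (\<tau> n) \<and> \<tau> n ` {0..1} = {0..1}) \<and>
        uniform_limit {0..1} \<tau> (\<lambda>t. t) sequentially \<and>
        uniform_limit {0..1} (\<lambda>n t. f n (\<tau> n t)) g sequentially)"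

definition skorokhod_continuous :: "((real \<Rightarrow> 'b::metric_space) \<Rightarrow> real) \<Rightarrow> bool" where
  "skorokhod_continuous \<Phi> \<longleftrightarrow>
     (\<forall>f g. (\<forall>n. f n \<in> cadlag01) \<and> g \<in> cadlag01 \<and> skorokhod_tendsto f g \<longrightarrow>
        (\<lambda>n. \<Phi> (f n)) \<longlonglongrightarrow> \<Phi> g)"

text \<open>
  The Borel sets of \<open>D[0,1]\<close> are generated by the evaluations, so a random element of \<open>D[0,1]\<close> is a
  family of random variables with paths in \<open>D[0,1]\<close>.
\<close>

definition random_cadlag01 :: "'a measure \<Rightarrow> ('a \<Rightarrow> real \<Rightarrow> 'b::metric_space) \<Rightarrow> bool" where
  "random_cadlag01 M X \<longleftrightarrow>
     (\<forall>\<alpha>\<in>{0..1}. (\<lambda>\<omega>. X \<omega> \<alpha>) \<in> borel_measurable M) \<and> (\<forall>\<omega>\<in>space M. X \<omega> \<in> cadlag01)"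

definition process_converges_weakly ::
  "'a measure \<Rightarrow> (nat \<Rightarrow> 'a \<Rightarrow> real \<Rightarrow> 'b::metric_space) \<Rightarrow>
   'c measure \<Rightarrow> ('c \<Rightarrow> real \<Rightarrow> 'b) \<Rightarrow> bool" where
  "process_converges_weakly M X M' G \<longleftrightarrow>
     (\<forall>n. random_cadlag01 M (X n)) \<and> random_cadlag01 M' G \<and>
     (\<forall>\<Phi>. skorokhod_continuous \<Phi> \<and> (\<exists>B. \<forall>f\<in>cadlag01. \<bar>\<Phi> f\<bar> \<le> B) \<longrightarrow>
        (\<lambda>n. \<integral>\<omega>. \<Phi> (X n \<omega>) \<partial>M) \<longlonglongrightarrow> (\<integral>\<omega>. \<Phi> (G \<omega>) \<partial>M'))"


section \<open>Gaussian laws and processes\<close>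

definition centered_normal :: "real \<Rightarrow> real measure" where
  "centered_normal v =
     (if v = 0 then return borel 0
      else density lborel (\<lambda>y. ennreal (normal_density 0 (sqrt v) y)))"

text \<open>The mean-zero Gaussian law on \<open>\<real>\<^sup>p\<close> with (possibly singular) covariance matrix \<open>S\<close>.\<close>

definition centered_gaussian :: "real ^ 'p ^ 'p \<Rightarrow> (real ^ 'p) measure \<Rightarrow> bool" where
  "centered_gaussian S \<mu> \<longleftrightarrow>
     prob_space \<mu> \<and> sets \<mu> = sets borel \<and>
     transpose S = S \<and> (\<forall>u. 0 \<le> u \<bullet> (S *v u)) \<and>
     (\<forall>u. distr \<mu> borel (\<lambda>y. u \<bullet> y) = centered_normal (u \<bullet> (S *v u)))"

text \<open>
  A mean-zero Gaussian process on \<open>[0,1]\<close> with independent increments whose value at time \<open>\<alpha>\<close> has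
  covariance matrix \<open>S \<alpha>\<close>: all finite-dimensional distributions are jointly Gaussian, increments
  over consecutive intervals are independent, and the marginals have the stated law.
\<close>

definition gaussian_indep_increments ::
  "'c measure \<Rightarrow> ('c \<Rightarrow> real \<Rightarrow> real ^ 'p) \<Rightarrow> (real \<Rightarrow> real ^ 'p ^ 'p) \<Rightarrow> bool" where
  "gaussian_indep_increments M G S \<longleftrightarrow>
     prob_space M \<and>
     (\<forall>\<alpha>\<in>{0..1}. (\<lambda>\<omega>. G \<omega> \<alpha>) \<in> borel_measurable M) \<and>
     (\<forall>A u. finite A \<and> A \<subseteq> {0..1} \<longrightarrow>
        (\<exists>v\<ge>0. distr M borel (\<lambda>\<omega>. \<Sum>\<alpha>\<in>A. u \<alpha> \<bullet> G \<omega> \<alpha>) = centered_normal v)) \<and>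
     (\<forall>(k::nat) a. (\<forall>i\<le>k. a i \<in> {0..1}) \<and> (\<forall>i<k. a i < a (Suc i)) \<longrightarrow>
        prob_space.indep_vars M (\<lambda>_. borel) (\<lambda>i \<omega>. G \<omega> (a (Suc i)) - G \<omega> (a i)) {..<k}) \<and>
     (\<forall>\<alpha>\<in>{0..1}. centered_gaussian (S \<alpha>) (distr M borel (\<lambda>\<omega>. G \<omega> \<alpha>)))"

end

theory Submission
  imports Defs
begin

text \<open>
  Every summand of the log partial likelihood is a linear function minus a log-sum-exp, so the log
  partial likelihood is smooth and concave on all of \<open>\<real>\<^sup>p\<close>.  Put
  \<open>S = \<Sigma> 1 \<beta>0\<close>, which is symmetric with \<open>v \<bullet> S v \<ge> c |v|\<^sup>2\<close>.  By the mean value theorem,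
  uniform convergence of the Hessian and Lipschitz continuity of \<open>\<Sigma> 1\<close> give, with high probability,
  \<open>|U(\<beta>) - U(\<beta>0) + n S (\<beta> - \<beta>0)| \<le> n e |\<beta> - \<beta>0|\<close> on a small ball around \<open>\<beta>0\<close>, for any \<open>e > 0\<close>.
  As \<open>U(\<beta>0)\<close> is of order \<open>\<surd>n\<close>, concavity forces the maximizers into that ball.  There
  \<open>U(\<beta>hat) = 0\<close>, hence \<open>|\<beta>hat - \<beta>0| \<le> 2 |U(\<beta>0)| / (n c)\<close> and
  \<open>\<surd>n S (\<beta>hat - \<beta>0) - U(\<beta>0) / \<surd>n\<close> tends to \<open>0\<close> in probability, so Slutsky's theorem transfers
  the limit law of \<open>S\<^sup>-\<^sup>1 U(\<beta>0) / \<surd>n\<close>, the image of the Gaussian law at time \<open>1\<close>.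
\<close>

section \<open>Smooth concave functions, the log partial likelihood and its maximizers\<close>

text \<open>Concavity is stated as the tangent inequality, the form in which it later confines
  maximizers. Differentiability of \<open>g\<close> makes the Hessian, a Jacobian of the gradient,
  meaningful at every point.\<close>

definition smooth_concave :: "('b::euclidean_space \<Rightarrow> real) \<Rightarrow> bool" where
  "smooth_concave f \<longleftrightarrow>
     (\<exists>g. (\<forall>b. GDERIV f b :> g b) \<and> (\<forall>b c. f c \<le> f b + g b \<bullet> (c - b)) \<and>
          (\<forall>b. g differentiable (at b)))"

lemma gradient_eqI: "GDERIV f b :> D \<Longrightarrow> gradient f b = D"
  unfolding gradient_def gderiv_def
proof (rule the_equality)
  fix D' assume "(f has_derivative (\<lambda>h. h \<bullet> D)) (at b)" "(f has_derivative (\<lambda>h. h \<bullet> D')) (at b)"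
  then have "(\<lambda>h. h \<bullet> D') = (\<lambda>h. h \<bullet> D)" by (rule has_derivative_unique[rotated])
  then show "D' = D" by (metis vector_eq_ldot)
qed

lemma smooth_concaveD:
  assumes "smooth_concave f"
  shows "GDERIV f b :> gradient f b" "f c \<le> f b + gradient f b \<bullet> (c - b)"
    "gradient f differentiable (at b)"
proof -
  obtain g where g: "\<And>b. GDERIV f b :> g b" "\<And>b c. f c \<le> f b + g b \<bullet> (c - b)"
    "\<And>b. g differentiable (at b)"
    using assms unfolding smooth_concave_def by blast
  have "gradient f = g" using g(1) gradient_eqI by blast
  then show "GDERIV f b :> gradient f b" "f c \<le> f b + gradient f b \<bullet> (c - b)"
    "gradient f differentiable (at b)" using g by auto
qed

lemma smooth_concave_inner: "smooth_concave (\<lambda>b. b \<bullet> a)"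
  unfolding smooth_concave_def gderiv_def
  by (intro exI[of _ "\<lambda>_. a"])
     (auto intro!: derivative_eq_intros simp: inner_diff_right inner_commute)

lemma smooth_concave_sum:
  assumes "\<And>m. m \<in> A \<Longrightarrow> smooth_concave (f m)"
  shows "smooth_concave (\<lambda>b. \<Sum>m\<in>A. f m b)"
  unfolding smooth_concave_def
proof (intro exI conjI allI)
  let ?g = "\<lambda>b. \<Sum>m\<in>A. gradient (f m) b"
  show "GDERIV (\<lambda>b. \<Sum>m\<in>A. f m b) b :> ?g b" for b
    using smooth_concaveD(1)[OF assms] unfolding gderiv_def
    by (auto simp: inner_sum_right intro!: has_derivative_sum)
  show "(\<Sum>m\<in>A. f m c) \<le> (\<Sum>m\<in>A. f m b) + ?g b \<bullet> (c - b)" for b c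
    using smooth_concaveD(2)[OF assms]
    by (auto simp: inner_sum_left sum.distrib[symmetric] intro!: sum_mono)
  \<comment> \<open>If \<open>A\<close> is infinite, the sum takes its default value 0 and
    \<open>?g\<close> is constant.\<close>
  show "?g differentiable (at b)" for b
    using smooth_concaveD(3)[OF assms]
    by (cases "finite A") (auto intro!: differentiable_sum)
qed

text \<open>The gradient of log-sum-exp is the mean of the \<open>x k\<close> under the weights
  \<open>exp (b \<bullet> x k)\<close> normalized to sum 1, and the tangent inequality is Jensen's
  inequality for \<open>exp\<close> under these weights.\<close>

lemma smooth_concave_neg_log_sum_exp:
  fixes x :: "'k \<Rightarrow> 'b::euclidean_space"
  assumes K: "finite K" "K \<noteq> {}"
  shows "smooth_concave (\<lambda>b. b \<bullet> a - ln (\<Sum>k\<in>K. exp (b \<bullet> x k)))"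
  unfolding smooth_concave_def
proof (intro exI conjI allI)
  let ?S = "\<lambda>b. \<Sum>k\<in>K. exp (b \<bullet> x k)"
  let ?g = "\<lambda>b. a - (1 / ?S b) *\<^sub>R (\<Sum>k\<in>K. exp (b \<bullet> x k) *\<^sub>R x k)"
  have S: "0 < ?S b" for b using K by (intro sum_pos) auto
  show "GDERIV (\<lambda>b. b \<bullet> a - ln (?S b)) b :> ?g b" for b
    unfolding gderiv_def using S[of b]
    by (auto intro!: derivative_eq_intros has_derivative_sum
        simp: fun_eq_iff inner_diff_right inner_sum_right divide_inverse mult.commute)
  show "?g differentiable (at b)" for b
  proof -
    have "(\<lambda>b. 1 / ?S b) differentiable (at b)"
      using S[of b] K(1) by (intro differentiable_divide differentiable_sum)
        (auto intro!: differentiableI derivative_eq_intros)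
    moreover have "(\<lambda>b. \<Sum>k\<in>K. exp (b \<bullet> x k) *\<^sub>R x k) differentiable (at b)"
      using K(1) by (intro differentiable_sum ballI)
        (auto intro!: differentiableI derivative_eq_intros)
    ultimately show ?thesis by (intro differentiable_diff differentiable_scaleR) auto
  qed
  show "c \<bullet> a - ln (?S c) \<le> b \<bullet> a - ln (?S b) + ?g b \<bullet> (c - b)" for b c
  proof -
    define w where "w k = exp (b \<bullet> x k) / ?S b" for k
    have w: "\<And>k. k \<in> K \<Longrightarrow> 0 \<le> w k" "sum w K = 1"
      using S[of b] by (auto simp: w_def sum_divide_distrib[symmetric])
    \<comment> \<open>The ratio \<open>?S c / ?S b\<close> is the \<open>w\<close>-mean of
      \<open>exp ((c - b) \<bullet> x k)\<close>, so Jensen's inequality bounds it from below;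
      taking \<open>ln\<close> gives the tangent inequality.\<close>
    have "exp (\<Sum>k\<in>K. w k *\<^sub>R ((c - b) \<bullet> x k)) \<le> (\<Sum>k\<in>K. w k * exp ((c - b) \<bullet> x k))"
      by (rule convex_on_sum[OF K exp_convex w(2) w(1)]) auto
    also have "\<dots> = ?S c / ?S b"
      by (auto simp: w_def sum_divide_distrib inner_diff_left exp_diff intro!: sum.cong)
    finally have "(\<Sum>k\<in>K. w k *\<^sub>R ((c - b) \<bullet> x k)) \<le> ln (?S c / ?S b)"
      using S by (simp add: ln_ge_iff)
    also have "\<dots> = ln (?S c) - ln (?S b)" using S[of b] S[of c] by (simp add: ln_div)
    finally have "(\<Sum>k\<in>K. w k * ((c - b) \<bullet> x k)) \<le> ln (?S c) - ln (?S b)" by simp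
    moreover have "(\<Sum>k\<in>K. w k * ((c - b) \<bullet> x k))
        = ((1 / ?S b) *\<^sub>R (\<Sum>k\<in>K. exp (b \<bullet> x k) *\<^sub>R x k)) \<bullet> (c - b)"
      by (simp add: w_def inner_sum_left sum_divide_distrib
          inner_commute[of "c - b"] del: inner_diff_right)
    ultimately show ?thesis by (simp add: inner_diff_left inner_diff_right inner_commute)
  qed
qed

text \<open>If the set of receivers is empty or infinite, then the logarithm is the junk value \<open>ln 0 = 0\<close>
  and the summand is linear.\<close>

lemma smooth_concave_log_PL: "smooth_concave (log_PL I J N x R t \<omega>)"
proof -
  have "smooth_concave (\<lambda>b. b \<bullet> a - ln (\<Sum>k\<in>K. exp (b \<bullet> y k)))"
    for a :: "real ^ 'p" and K :: "'v set" and y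
    using smooth_concave_neg_log_sum_exp[of K a y] smooth_concave_inner[of a]
    by (cases "finite K \<and> K \<noteq> {}") auto
  then show ?thesis
    unfolding log_PL_def Let_def split_beta by (intro smooth_concave_sum)
qed

lemma smooth_concave_hessian:
  fixes f :: "real ^ 'p \<Rightarrow> real"
  assumes "smooth_concave f"
  shows "(gradient f has_derivative (\<lambda>v. hessian f b *v v)) (at b)"
  using smooth_concaveD(3)[OF assms] by (auto simp: hessian_def jacobian_works)

text \<open>If the gradient is close to an affine map with a definite linear part, then concavity confines
  the maximizers to the ball on which this is known.\<close>

lemma concave_argmax_localization:
  fixes f :: "'b::euclidean_space \<Rightarrow> real" and S :: "'b \<Rightarrow> 'b"
  assumes f: "smooth_concave f" and r: "0 < r" and e: "e \<le> c / 2" and c: "0 < c"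
    and lin: "\<forall>b\<in>cball b0 r.
      norm (gradient f b - gradient f b0 + S (b - b0)) \<le> e * norm (b - b0)"
    and coer: "\<And>v. c * (norm v)\<^sup>2 \<le> v \<bullet> S v"
    and small: "norm (gradient f b0) < c / 2 * r"
  shows "\<exists>b. is_arg_max f (\<lambda>_. True) b"
    and "is_arg_max f (\<lambda>_. True) b \<Longrightarrow> norm (b - b0) \<le> r"
    and "is_arg_max f (\<lambda>_. True) b \<Longrightarrow> norm (b - b0) \<le> 2 / c * norm (gradient f b0)"
    and "is_arg_max f (\<lambda>_. True) b \<Longrightarrow>
      norm (S (b - b0) - gradient f b0) \<le> e * norm (b - b0)"
proof -
  note D = smooth_concaveD[OF f]
  \<comment> \<open>One half of the coercivity constant \<open>c\<close> absorbs the linearization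
    error, since \<open>e \<le> c / 2\<close>; the other half remains as an inward pull.\<close>
  have slope: "gradient f b \<bullet> (b - b0) \<le> norm (b - b0) * (norm (gradient f b0) - c / 2 * norm (b - b0))"
    if b: "b \<in> cball b0 r" for b
  proof -
    define E where "E = gradient f b - gradient f b0 + S (b - b0)"
    have "gradient f b \<bullet> (b - b0) = E \<bullet> (b - b0) + gradient f b0 \<bullet> (b - b0) - (b - b0) \<bullet> S (b - b0)"
      by (simp add: E_def inner_add_left inner_diff_left[of "gradient f b"]
          inner_commute[of "b - b0" "S (b - b0)"] del: inner_diff_left inner_diff_right)
    moreover have "E \<bullet> (b - b0) \<le> c / 2 * norm (b - b0) * norm (b - b0)"
    proof -
      have "E \<bullet> (b - b0) \<le> norm E * norm (b - b0)" by (rule norm_cauchy_schwarz)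
      also have "\<dots> \<le> (c / 2 * norm (b - b0)) * norm (b - b0)"
        using bspec[OF lin b] e unfolding E_def[symmetric]
        by (intro mult_right_mono order_trans[OF bspec[OF lin b, folded E_def]]) auto
      finally show ?thesis .
    qed
    moreover have "gradient f b0 \<bullet> (b - b0) \<le> norm (gradient f b0) * norm (b - b0)"
      by (rule norm_cauchy_schwarz)
    ultimately show ?thesis using coer[of "b - b0"]
      by (simp add: algebra_simps power2_eq_square)
  qed
  \<comment> \<open>\<open>z\<close> is the radial projection of \<open>b\<close> onto the sphere of
    radius \<open>r\<close>. There the slope bound makes the outward slope negative, and the tangent
    inequality at \<open>z\<close> carries this out to \<open>b\<close>.\<close>
  have outside: "\<exists>z\<in>cball b0 r. f b < f z" if b: "r < norm (b - b0)" for b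
  proof -
    define s where "s = norm (b - b0) / r - 1"
    define z where "z = b0 + (r / norm (b - b0)) *\<^sub>R (b - b0)"
    have s: "s > 0" using b r by (simp add: s_def)
    have "norm (b - b0) \<noteq> 0" using b r by linarith
    then have bb0: "b \<noteq> b0" by auto
    then have nz: "norm (z - b0) = r" using r by (simp add: z_def)
    then have z: "z \<in> cball b0 r" by (simp add: dist_norm norm_minus_commute)
    from bb0 r have "(norm (b - b0) / r) *\<^sub>R (z - b0) = b - b0"
      using r by (simp add: z_def)
    then have bz: "b - z = s *\<^sub>R (z - b0)" by (simp add: s_def algebra_simps)
    have "gradient f z \<bullet> (z - b0) < 0"
      using slope[OF z] small r unfolding nz
      by (intro order_le_less_trans[OF slope[OF z, unfolded nz]] mult_pos_neg) auto
    then have "gradient f z \<bullet> (b - z) < 0" using s by (simp add: bz mult_pos_neg)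
    then have "f b < f z" using D(2)[of b z] by simp
    with z show ?thesis by blast
  qed
  have cont: "continuous_on (cball b0 r) f"
    using D(1) unfolding gderiv_def
    by (intro continuous_at_imp_continuous_on ballI) (blast intro: has_derivative_continuous)
  obtain m where m: "m \<in> cball b0 r" "\<And>y. y \<in> cball b0 r \<Longrightarrow> f y \<le> f m"
    using continuous_attains_sup[OF _ _ cont] r by auto
  \<comment> \<open>A maximizer on the compact ball is global, because every outside point is beaten
    by a point of the ball.\<close>
  have "f y \<le> f m" for y
  proof (cases "y \<in> cball b0 r")
    case False
    then obtain z where "z \<in> cball b0 r" "f y < f z"
      using outside[of y] by (auto simp: dist_norm norm_minus_commute not_le)
    with m(2)[of z] show ?thesis by simp
  qed (use m in auto)
  then show "\<exists>b. is_arg_max f (\<lambda>_. True) b" by (auto simp: is_arg_max_def not_less)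
  assume "is_arg_max f (\<lambda>_. True) b"
  then have max: "f y \<le> f b" for y by (auto simp: is_arg_max_def not_less)
  show "norm (b - b0) \<le> r" using outside[of b] max by (meson not_le)
  then have b: "b \<in> cball b0 r" by (simp add: dist_norm norm_minus_commute)
  \<comment> \<open>\<open>b\<close> maximizes over the whole space, so the first-order condition
    holds even if \<open>b\<close> lies on the boundary of the ball.\<close>
  have "(\<lambda>h. h \<bullet> gradient f b) = (\<lambda>_. 0)"
    using D(1)[of b] max unfolding gderiv_def
    by (intro has_derivative_local_max) (auto)
  then have g0: "gradient f b = 0" by (metis inner_eq_zero_iff)
  \<comment> \<open>The left side of \<open>slope\<close> is now 0, so for
    \<open>b \<noteq> b0\<close> the second factor on its right side is nonnegative.\<close>
  show "norm (b - b0) \<le> 2 / c * norm (gradient f b0)"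
    using slope[OF b] c by (cases "b = b0") (auto simp: g0 field_simps zero_le_mult_iff)
  show "norm (S (b - b0) - gradient f b0) \<le> e * norm (b - b0)"
    using bspec[OF lin b] by (simp add: g0)
qed

section \<open>Coercive matrices and Gaussian laws\<close>

lemma spectral_norm_bound: "norm (A *v v) \<le> spectral_norm A * norm (v :: real ^ 'p)"
  unfolding spectral_norm_def by (rule onorm) (simp add: matrix_vector_mul_bounded_linear)

lemma spectral_norm_nonneg: "0 \<le> spectral_norm (A :: real ^ 'p ^ 'p)"
  unfolding spectral_norm_def by (rule onorm_pos_le) (simp add: matrix_vector_mul_bounded_linear)

text \<open>The Rayleigh quotient attains its minimum at an eigenvector.\<close>

lemma eigenvalues_ge_imp_coercive:
  fixes S :: "real ^ 'p ^ 'p"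
  assumes sym: "transpose S = S" and ev: "\<And>k. is_eigenvalue S k \<Longrightarrow> c \<le> k"
  shows "c * (norm v)\<^sup>2 \<le> v \<bullet> (S *v v)"
proof -
  have symm: "v \<bullet> (S *v w) = w \<bullet> (S *v v)" for v w
  proof -
    have "v \<bullet> (S *v w) = (transpose S *v v) \<bullet> w"
      by (simp add: transpose_matrix_vector dot_lmul_matrix)
    then show ?thesis by (simp add: sym inner_commute)
  qed
  have "continuous_on (sphere 0 1) (\<lambda>v. v \<bullet> (S *v v))"
    by (intro continuous_intros linear_continuous_on matrix_vector_mul_bounded_linear)
  moreover have "(sphere 0 1 :: (real ^ 'p) set) \<noteq> {}" by simp
  ultimately obtain u where "u \<in> sphere 0 1"
    "\<forall>w\<in>sphere 0 1. u \<bullet> (S *v u) \<le> w \<bullet> (S *v w)"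
    using continuous_attains_inf[OF compact_sphere] by blast
  then have u: "norm u = 1" "\<And>w. norm w = 1 \<Longrightarrow> u \<bullet> (S *v u) \<le> w \<bullet> (S *v w)" by auto
  define k where "k = u \<bullet> (S *v u)"
  have min: "k * (norm w)\<^sup>2 \<le> w \<bullet> (S *v w)" for w
  proof (cases "w = 0")
    case False
    then have "k \<le> ((1 / norm w) *\<^sub>R w) \<bullet> (S *v ((1 / norm w) *\<^sub>R w))"
      unfolding k_def by (intro u(2)) simp
    also have "\<dots> = (w \<bullet> (S *v w)) / (norm w)\<^sup>2"
      by (simp add: matrix_vector_mult_scaleR power2_eq_square)
    finally show ?thesis using False by (simp add: field_simps)
  qed simp
  \<comment> \<open>This is half the first variation at the minimizer \<open>u\<close> in direction
    \<open>w\<close>; once it vanishes for every \<open>w\<close>, \<open>u\<close> is an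
    eigenvector with eigenvalue \<open>k\<close>.\<close>
  have "w \<bullet> (S *v u - k *\<^sub>R u) = 0" for w
  proof -
    define p where "p = 2 * (w \<bullet> (S *v u - k *\<^sub>R u))"
    define q where "q = w \<bullet> (S *v w) - k * (norm w)\<^sup>2"
    have pq: "0 \<le> t * p + t\<^sup>2 * q" for t
    proof -
      have "0 \<le> (u + t *\<^sub>R w) \<bullet> (S *v (u + t *\<^sub>R w)) - k * (norm (u + t *\<^sub>R w))\<^sup>2"
        using min by simp
      also have "\<dots> = t * p + t\<^sup>2 * q + (u \<bullet> (S *v u) - k * (norm u)\<^sup>2)"
        unfolding p_def q_def power2_norm_eq_inner
        by (simp add: matrix_vector_right_distrib matrix_vector_mult_scaleR inner_add_left inner_add_right
            inner_diff_right symm[of u w] inner_commute[of u w] algebra_simps power2_eq_square)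
      finally show ?thesis using u(1) by (simp add: k_def)
    qed
    have "p = 0"
    proof (rule ccontr)
      assume "p \<noteq> 0"
      \<comment> \<open>With this \<open>t\<close>, \<open>t * p\<close> equals
        \<open>- t\<^sup>2 * (\<bar>q\<bar> + 1)\<close>, so the linear term outweighs the quadratic
        one.\<close>
      define t where "t = - p / (\<bar>q\<bar> + 1)"
      have "t * p + t\<^sup>2 * q \<le> t * p + t\<^sup>2 * \<bar>q\<bar>"
        by (intro add_left_mono mult_left_mono) auto
      also have "\<dots> = t\<^sup>2 * (\<bar>q\<bar> - (\<bar>q\<bar> + 1))"
        by (simp add: t_def power2_eq_square divide_simps) (simp add: algebra_simps)
      also have "\<dots> < 0" using \<open>p \<noteq> 0\<close> by (simp add: t_def)
      finally show False using pq[of t] by simp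
    qed
    then show ?thesis by (simp add: p_def)
  qed
  then have "S *v u - k *\<^sub>R u = 0" using inner_eq_zero_iff by blast
  then have "S *v u = k *\<^sub>R u" by simp
  with u(1) have "is_eigenvalue S k" unfolding is_eigenvalue_def by (intro exI[of _ u]) auto
  then have "c * (norm v)\<^sup>2 \<le> k * (norm v)\<^sup>2" by (intro mult_right_mono ev) auto
  with min show ?thesis by (rule order_trans[rotated])
qed

lemma coercive_imp_invertible:
  fixes S :: "real ^ 'p ^ 'p"
  assumes "0 < c" "\<And>v. c * (norm v)\<^sup>2 \<le> v \<bullet> (S *v v)"
  shows "invertible S"
proof -
  have "v = 0" if "S *v v = 0" for v
    using assms(2)[of v] assms(1) that by (simp add: mult_le_0_iff)
  then show ?thesis
    by (simp add: invertible_left_inverse matrix_left_invertible_ker)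
qed

text \<open>Pairing with \<open>u\<close> after applying \<open>A\<close> is pairing with
  \<open>transpose A *v u\<close> before it, so each one-dimensional projection of the image is a
  projection of \<open>\<mu>\<close>.\<close>

lemma centered_gaussian_linear_image:
  fixes S A :: "real ^ 'p ^ 'p"
  assumes \<mu>: "centered_gaussian S \<mu>"
  shows "centered_gaussian (A ** S ** transpose A) (distr \<mu> borel (\<lambda>y. A *v y))"
proof -
  have \<mu>': "prob_space \<mu>" "sets \<mu> = sets borel" "transpose S = S" "\<And>u. 0 \<le> u \<bullet> (S *v u)"
    "\<And>u. distr \<mu> borel (\<lambda>y. u \<bullet> y) = centered_normal (u \<bullet> (S *v u))"
    using \<mu> by (auto simp: centered_gaussian_def)
  have adj: "u \<bullet> (A *v y) = (transpose A *v u) \<bullet> y" for u y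
    by (simp add: transpose_matrix_vector dot_lmul_matrix)
  have quad: "u \<bullet> ((A ** S ** transpose A) *v u) = (transpose A *v u) \<bullet> (S *v (transpose A *v u))" for u
    by (simp add: adj matrix_vector_mul_assoc[symmetric])
  have meas: "(\<lambda>y. A *v y) \<in> measurable \<mu> borel"
    unfolding measurable_cong_sets[OF \<mu>'(2) refl]
    by (intro borel_measurable_continuous_onI linear_continuous_on matrix_vector_mul_bounded_linear)
  have "distr (distr \<mu> borel (\<lambda>y. A *v y)) borel (\<lambda>y. u \<bullet> y)
      = centered_normal (u \<bullet> ((A ** S ** transpose A) *v u))" for u
    using meas \<mu>'(5)[of "transpose A *v u"] by (simp add: distr_distr comp_def adj quad)
  moreover have "transpose (A ** S ** transpose A) = A ** S ** transpose A"
    by (simp add: matrix_transpose_mul \<mu>'(3) matrix_mul_assoc)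
  ultimately show ?thesis
    unfolding centered_gaussian_def using \<mu>' meas
    by (auto simp: quad prob_space.prob_space_distr)
qed

section \<open>Events of high probability\<close>

text \<open>The events \<open>P n\<close> need not be measurable: the failure probability is an outer one.\<close>

definition with_high_prob :: "'a measure \<Rightarrow> (nat \<Rightarrow> 'a \<Rightarrow> bool) \<Rightarrow> bool" where
  "with_high_prob M P \<longleftrightarrow>
     (\<forall>\<eta>>0. \<forall>\<^sub>F n in sequentially.
        \<exists>A\<in>sets M. measure M A \<le> \<eta> \<and> (\<forall>\<omega>\<in>space M - A. P n \<omega>))"

lemma with_high_probD:
  assumes "with_high_prob M P" "0 < \<eta>"
  shows "\<forall>\<^sub>F n in sequentially. \<exists>A\<in>sets M. measure M A \<le> \<eta> \<and> (\<forall>\<omega>\<in>space M - A. P n \<omega>)"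
  using assms by (simp add: with_high_prob_def)

lemma with_high_prob_mono:
  assumes "with_high_prob M P" "\<forall>\<^sub>F n in sequentially. \<forall>\<omega>\<in>space M. P n \<omega> \<longrightarrow> Q n \<omega>"
  shows "with_high_prob M Q"
  unfolding with_high_prob_def
proof (intro allI impI)
  fix \<eta> :: real assume "0 < \<eta>"
  then have "\<forall>\<^sub>F n in sequentially. \<exists>A\<in>sets M. measure M A \<le> \<eta> \<and> (\<forall>\<omega>\<in>space M - A. P n \<omega>)"
    using assms(1) by (auto simp: with_high_prob_def)
  with assms(2) show "\<forall>\<^sub>F n in sequentially. \<exists>A\<in>sets M. measure M A \<le> \<eta> \<and> (\<forall>\<omega>\<in>space M - A. Q n \<omega>)"
    by eventually_elim blast
qed

lemma with_high_prob_I_measure: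
  assumes "\<And>n. {\<omega> \<in> space M. \<not> P n \<omega>} \<in> sets M"
    "(\<lambda>n. measure M {\<omega> \<in> space M. \<not> P n \<omega>}) \<longlonglongrightarrow> 0"
  shows "with_high_prob M P"
  unfolding with_high_prob_def
proof (intro allI impI)
  fix \<eta> :: real assume "0 < \<eta>"
  from order_tendstoD(2)[OF assms(2) this]
  show "\<forall>\<^sub>F n in sequentially. \<exists>A\<in>sets M. measure M A \<le> \<eta> \<and> (\<forall>\<omega>\<in>space M - A. P n \<omega>)"
    by eventually_elim (use assms(1) in \<open>auto intro!: bexI[of _ "{\<omega> \<in> space M. \<not> P _ \<omega>}"]\<close>)
qed

lemma with_high_prob_eventually:
  assumes "\<forall>\<^sub>F n in sequentially. \<forall>\<omega>\<in>space M. P n \<omega>"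
  shows "with_high_prob M P"
  unfolding with_high_prob_def
  using assms by (auto elim!: eventually_mono intro!: bexI[of _ "{}"])

lemma converges_in_prob_on_imp_with_high_prob:
  assumes "converges_in_prob_on M V H S" "0 < \<epsilon>"
  shows "with_high_prob M (\<lambda>n \<omega>. \<forall>\<beta>\<in>V. spectral_norm (H n \<omega> \<beta> - S \<beta>) \<le> \<epsilon>)"
  using assms by (intro with_high_prob_I_measure) (auto simp: converges_in_prob_on_def not_le)

context prob_space
begin

lemma with_high_prob_conj:
  assumes "with_high_prob M P" "with_high_prob M Q"
  shows "with_high_prob M (\<lambda>n \<omega>. P n \<omega> \<and> Q n \<omega>)"
  unfolding with_high_prob_def
proof (intro allI impI)
  fix \<eta> :: real assume "0 < \<eta>"
  then have "\<forall>\<^sub>F n in sequentially. \<exists>A\<in>sets M. measure M A \<le> \<eta> / 2 \<and> (\<forall>\<omega>\<in>space M - A. P n \<omega>)"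
    and "\<forall>\<^sub>F n in sequentially. \<exists>A\<in>sets M. measure M A \<le> \<eta> / 2 \<and> (\<forall>\<omega>\<in>space M - A. Q n \<omega>)"
    using assms by (intro with_high_probD; simp)+
  then show "\<forall>\<^sub>F n in sequentially. \<exists>A\<in>sets M. measure M A \<le> \<eta> \<and> (\<forall>\<omega>\<in>space M - A. P n \<omega> \<and> Q n \<omega>)"
  proof eventually_elim
    case (elim n)
    then obtain A B where *: "A \<in> sets M" "measure M A \<le> \<eta> / 2" "\<forall>\<omega>\<in>space M - A. P n \<omega>"
      "B \<in> sets M" "measure M B \<le> \<eta> / 2" "\<forall>\<omega>\<in>space M - B. Q n \<omega>" by blast
    then have "measure M (A \<union> B) \<le> \<eta>"
      using measure_Un_le[of A M B] by simp
    with * show ?case by (intro bexI[of _ "A \<union> B"]) auto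
  qed
qed

lemma with_high_prob_AE:
  assumes "AE \<omega> in M. \<forall>n. P n \<omega>"
  shows "with_high_prob M P"
proof -
  obtain A where "{\<omega> \<in> space M. \<not> (\<forall>n. P n \<omega>)} \<subseteq> A" "emeasure M A = 0" "A \<in> sets M"
    using AE_E[OF assms] by blast
  then show ?thesis
    unfolding with_high_prob_def by (intro allI impI always_eventually bexI[of _ A]) (auto simp: measure_def)
qed

lemma with_high_prob_tendsto_0:
  assumes P: "with_high_prob M P"
  shows "(\<lambda>n. prob {\<omega> \<in> space M. \<not> P n \<omega>}) \<longlonglongrightarrow> 0"
proof (rule order_tendstoI)
  show "\<forall>\<^sub>F n in sequentially. a < prob {\<omega> \<in> space M. \<not> P n \<omega>}" if "a < 0" for a
    using that by (intro always_eventually allI less_le_trans[OF that]) simp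
  fix a :: real assume a: "0 < a"
  then have "\<forall>\<^sub>F n in sequentially. \<exists>A\<in>sets M. prob A \<le> a / 2 \<and> (\<forall>\<omega>\<in>space M - A. P n \<omega>)"
    by (intro with_high_probD[OF P]) simp
  then show "\<forall>\<^sub>F n in sequentially. prob {\<omega> \<in> space M. \<not> P n \<omega>} < a"
  proof eventually_elim
    case (elim n)
    then obtain A where "A \<in> sets M" "prob A \<le> a / 2" "{\<omega> \<in> space M. \<not> P n \<omega>} \<subseteq> A" by blast
    \<comment> \<open>A failure set outside \<open>sets M\<close> has measure 0 by default, so the
      bound by \<open>A\<close> covers it too.\<close>
    then have "prob {\<omega> \<in> space M. \<not> P n \<omega>} \<le> a / 2" using finite_measure_mono by (meson order_trans)
    with a show ?case by simp
  qed
qed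

lemma converges_in_prob_if_with_high_prob:
  fixes X :: "nat \<Rightarrow> 'a \<Rightarrow> 'b::{metric_space, second_countable_topology}"
  assumes "\<And>n. X n \<in> borel_measurable M" "\<And>\<epsilon>. 0 < \<epsilon> \<Longrightarrow> with_high_prob M (\<lambda>n \<omega>. dist (X n \<omega>) c \<le> \<epsilon>)"
  shows "converges_in_prob M X c"
  unfolding converges_in_prob_def
  using assms(1) with_high_prob_tendsto_0[OF assms(2)] by (simp add: not_le)

section \<open>Tightness and Slutsky's theorem\<close>

text \<open>Continuous cutoffs of the tail serve as test functions: dominated convergence makes
  their \<open>\<mu>\<close>-integrals small, and convergence in law carries the bound for one fixed
  \<open>k\<close> over to all large \<open>n\<close>.\<close>

lemma converges_in_law_tight:
  fixes X :: "nat \<Rightarrow> 'a \<Rightarrow> 'b::euclidean_space"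
  assumes X: "converges_in_law M X \<mu>" and \<mu>: "prob_space \<mu>" "sets \<mu> = sets borel" and \<eta>: "0 < \<eta>"
  obtains K where "0 < K" "\<forall>\<^sub>F n in sequentially. prob {\<omega> \<in> space M. K < norm (X n \<omega>)} \<le> \<eta>"
proof -
  interpret \<mu>: prob_space \<mu> by (rule \<mu>)
  \<comment> \<open>continuous cutoff functions with \<open>indicator {y. k + 1 < norm y} \<le> \<phi> k\<close>\<close>
  define \<phi> where "\<phi> k y = min 1 (max 0 (norm y - real k))" for k and y :: 'b
  have \<phi>: "continuous_on UNIV (\<phi> k)" "bounded (range (\<phi> k))" "0 \<le> \<phi> k y" "\<phi> k y \<le> 1" for k y
  proof -
    show "continuous_on UNIV (\<phi> k)" unfolding \<phi>_def by (intro continuous_intros)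
    show "0 \<le> \<phi> k y" "\<phi> k y \<le> 1" for y by (auto simp: \<phi>_def)
    then show "bounded (range (\<phi> k))" by (intro boundedI[of _ 1]) (auto simp: abs_le_iff intro: order_trans[of _ 0])
  qed
  have meas: "\<phi> k \<in> borel_measurable borel" for k
    using \<phi>(1) by (rule borel_measurable_continuous_onI)
  have "(\<lambda>k. \<integral>y. \<phi> k y \<partial>\<mu>) \<longlonglongrightarrow> (\<integral>y. 0 \<partial>\<mu>)"
  proof (rule integral_dominated_convergence[where w="\<lambda>_. 1"])
    show "AE y in \<mu>. (\<lambda>k. \<phi> k y) \<longlonglongrightarrow> 0"
    proof (intro always_eventually allI)
      fix y :: 'b
      have "\<forall>\<^sub>F k in sequentially. norm y \<le> real k"
        using eventually_ge_at_top[of "nat \<lceil>norm y\<rceil>"] by eventually_elim linarith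
      then have "\<forall>\<^sub>F k in sequentially. \<phi> k y = 0" by eventually_elim (simp add: \<phi>_def)
      then show "(\<lambda>k. \<phi> k y) \<longlonglongrightarrow> 0" by (rule tendsto_eventually)
    qed
  qed (use meas \<phi>(3,4) in \<open>auto simp: measurable_cong_sets[OF \<mu>(2) refl]\<close>)
  then have "\<forall>\<^sub>F k in sequentially. (\<integral>y. \<phi> k y \<partial>\<mu>) < \<eta>" using \<eta> by (intro order_tendstoD) auto
  then obtain k where k: "(\<integral>y. \<phi> k y \<partial>\<mu>) < \<eta>" by (auto simp: eventually_sequentially)
  have Xm: "X n \<in> borel_measurable M" for n using X by (simp add: converges_in_law_def)
  have "(\<lambda>n. \<integral>\<omega>. \<phi> k (X n \<omega>) \<partial>M) \<longlonglongrightarrow> (\<integral>y. \<phi> k y \<partial>\<mu>)"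
    using X \<phi>(1,2) by (simp add: converges_in_law_def)
  from order_tendstoD(2)[OF this k]
  have "\<forall>\<^sub>F n in sequentially. prob {\<omega> \<in> space M. real k + 1 < norm (X n \<omega>)} \<le> \<eta>"
  proof eventually_elim
    case (elim n)
    have [measurable]: "X n \<in> borel_measurable M" by (rule Xm)
    have [measurable]: "\<phi> k \<in> borel_measurable borel" by (rule meas)
    let ?A = "{\<omega> \<in> space M. real k + 1 < norm (X n \<omega>)}"
    have "prob ?A = (\<integral>\<omega>. indicator ?A \<omega> \<partial>M)" by simp
    also have "\<dots> \<le> (\<integral>\<omega>. \<phi> k (X n \<omega>) \<partial>M)"
    proof (rule integral_mono)
      show "integrable M (\<lambda>\<omega>. \<phi> k (X n \<omega>))"
        using \<phi>(3,4) by (intro integrable_const_bound[of _ 1]) (auto)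
      show "indicator ?A \<omega> \<le> \<phi> k (X n \<omega>)" for \<omega>
        by (auto simp: indicator_def \<phi>_def)
    qed (auto simp: less_top[symmetric])
    finally show ?case using elim by simp
  qed
  \<comment> \<open>\<open>\<phi> k\<close> reaches 1 only at norm \<open>k + 1\<close>, hence this
    radius.\<close>
  then show ?thesis by (intro that[of "real k + 1"]) auto
qed

text \<open>A continuous \<open>g\<close> is uniformly continuous on compact balls, and tightness of
  \<open>X\<close> keeps both sequences in one ball outside an event of small probability.\<close>

lemma slutsky:
  fixes X Y :: "nat \<Rightarrow> 'a \<Rightarrow> 'b::euclidean_space"
  assumes X: "converges_in_law M X \<mu>" and \<mu>: "prob_space \<mu>" "sets \<mu> = sets borel"
    and Y: "\<And>n. Y n \<in> borel_measurable M"
    and close: "\<And>\<epsilon>. 0 < \<epsilon> \<Longrightarrow> with_high_prob M (\<lambda>n \<omega>. norm (Y n \<omega> - X n \<omega>) \<le> \<epsilon>)"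
  shows "converges_in_law M Y \<mu>"
  unfolding converges_in_law_def
proof (intro conjI allI impI)
  have Xm [measurable]: "X n \<in> borel_measurable M" for n using X by (simp add: converges_in_law_def)
  note Y[measurable]
  fix g :: "'b \<Rightarrow> real" assume g: "continuous_on UNIV g \<and> bounded (range g)"
  have [measurable]: "g \<in> borel_measurable borel" using g by (auto intro: borel_measurable_continuous_onI)
  obtain B where B: "0 < B" "\<And>y. \<bar>g y\<bar> \<le> B"
    using g by (auto simp: bounded_pos)
  have int: "integrable M (\<lambda>\<omega>. g (X n \<omega>))" "integrable M (\<lambda>\<omega>. g (Y n \<omega>))" for n
    using B(2) by (auto intro!: integrable_const_bound[of _ B])
  have "(\<lambda>n. (\<integral>\<omega>. g (Y n \<omega>) \<partial>M) - (\<integral>\<omega>. g (X n \<omega>) \<partial>M)) \<longlonglongrightarrow> 0"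
  proof (rule tendstoI)
    fix e :: real assume e: "0 < e"
    \<comment> \<open>The exceptional event \<open>C\<close> below has probability at most
      \<open>2 * \<eta>\<close>, and \<open>g\<close> varies by at most \<open>2 * B\<close> there,
      which costs \<open>e / 2\<close>; uniform continuity costs another
      \<open>e / 4\<close>.\<close>
    define \<eta> where "\<eta> = e / (8 * B)"
    have \<eta>: "0 < \<eta>" using e B(1) by (simp add: \<eta>_def)
    obtain K where K: "0 < K" "\<forall>\<^sub>F n in sequentially. prob {\<omega> \<in> space M. K < norm (X n \<omega>)} \<le> \<eta>"
      using converges_in_law_tight[OF X \<mu> \<eta>] by blast
    have "uniformly_continuous_on (cball 0 (K + 1)) g"
      using g by (intro compact_uniformly_continuous) (auto intro: continuous_on_subset)
    then obtain d where d: "0 < d" "\<And>y z. \<lbrakk>y \<in> cball 0 (K + 1); z \<in> cball 0 (K + 1); dist z y < d\<rbrakk>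
        \<Longrightarrow> dist (g z) (g y) < e / 4"
      using e unfolding uniformly_continuous_on_def by (metis divide_pos_pos zero_less_numeral)
    \<comment> \<open>The bound 1 keeps \<open>Y n\<close> in the ball of radius
      \<open>K + 1\<close>; \<open>d / 2\<close> gives a distance strictly below
      \<open>d\<close>.\<close>
    define \<delta> where "\<delta> = min 1 (d / 2)"
    have "\<forall>\<^sub>F n in sequentially. \<exists>A\<in>sets M. prob A \<le> \<eta> \<and> (\<forall>\<omega>\<in>space M - A. norm (Y n \<omega> - X n \<omega>) \<le> \<delta>)"
      using d(1) \<eta> by (intro with_high_probD close) (auto simp: \<delta>_def)
    with K(2) show "\<forall>\<^sub>F n in sequentially.
        dist ((\<integral>\<omega>. g (Y n \<omega>) \<partial>M) - (\<integral>\<omega>. g (X n \<omega>) \<partial>M)) 0 < e"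
    proof eventually_elim
      case (elim n)
      then obtain A where A[measurable]: "A \<in> sets M" and
        A': "prob A \<le> \<eta>" "\<And>\<omega>. \<omega> \<in> space M - A \<Longrightarrow> norm (Y n \<omega> - X n \<omega>) \<le> \<delta>" by blast
      define C where "C = A \<union> {\<omega> \<in> space M. K < norm (X n \<omega>)}"
      have C[measurable]: "C \<in> sets M" by (simp add: C_def)
      have "prob C \<le> 2 * \<eta>"
        using measure_Un_le[of A M "{\<omega> \<in> space M. K < norm (X n \<omega>)}"] A'(1) elim(1)
        by (simp add: C_def)
      then have "2 * B * prob C \<le> 2 * B * (2 * \<eta>)" using B(1) by simp
      also have "\<dots> = e / 2" using B(1) by (simp add: \<eta>_def)
      finally have C_le: "2 * B * prob C \<le> e / 2" .
      have pt: "\<bar>g (Y n \<omega>) - g (X n \<omega>)\<bar> \<le> e / 4 + 2 * B * indicator C \<omega>" if "\<omega> \<in> space M" for \<omega>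
      proof (cases "\<omega> \<in> C")
        case True
        then show ?thesis using B(2)[of "Y n \<omega>"] B(2)[of "X n \<omega>"] e by simp
      next
        case False
        then have *: "norm (X n \<omega>) \<le> K" "norm (Y n \<omega> - X n \<omega>) \<le> \<delta>"
          using that A'(2) by (auto simp: C_def not_less)
        then have "norm (Y n \<omega>) \<le> K + 1"
          using norm_triangle_ineq[of "Y n \<omega> - X n \<omega>" "X n \<omega>"] by (simp add: \<delta>_def)
        with * have "dist (g (Y n \<omega>)) (g (X n \<omega>)) < e / 4"
          using d(1) by (intro d(2)) (auto simp: dist_norm \<delta>_def)
        then show ?thesis using False by (simp add: dist_real_def)
      qed
      have "\<bar>(\<integral>\<omega>. g (Y n \<omega>) \<partial>M) - (\<integral>\<omega>. g (X n \<omega>) \<partial>M)\<bar> = \<bar>\<integral>\<omega>. g (Y n \<omega>) - g (X n \<omega>) \<partial>M\<bar>"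
        using int by simp
      also have "\<dots> \<le> (\<integral>\<omega>. \<bar>g (Y n \<omega>) - g (X n \<omega>)\<bar> \<partial>M)" by (rule integral_abs_bound)
      also have "\<dots> \<le> (\<integral>\<omega>. e / 4 + 2 * B * indicator C \<omega> \<partial>M)"
        using int pt by (intro integral_mono) (auto simp: less_top[symmetric])
      also have "\<dots> = e / 4 + 2 * B * prob C"
        by (simp add: less_top[symmetric] prob_space)
      finally show ?case using C_le e by (simp add: dist_real_def)
    qed
  qed
  moreover have "(\<lambda>n. \<integral>\<omega>. g (X n \<omega>) \<partial>M) \<longlonglongrightarrow> (\<integral>y. g y \<partial>\<mu>)"
    using X g by (simp add: converges_in_law_def)
  ultimately show "(\<lambda>n. \<integral>\<omega>. g (Y n \<omega>) \<partial>M) \<longlonglongrightarrow> (\<integral>y. g y \<partial>\<mu>)"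
    by (rule Lim_transform[rotated])
qed (rule Y)

end

section \<open>Consequences of weak convergence\<close>

text \<open>Time changes of [0,1] fix the endpoint 1, so evaluation there is Skorokhod continuous,
  and bounded continuous functions of \<open>X n \<omega> 1\<close> are admissible test
  functionals.\<close>

lemma process_converges_weakly_endpoint:
  assumes "process_converges_weakly M X M' G"
  shows "converges_in_law M (\<lambda>n \<omega>. X n \<omega> 1) (distr M' borel (\<lambda>\<omega>. G \<omega> 1))"
  unfolding converges_in_law_def
proof (intro conjI allI impI)
  show "(\<lambda>\<omega>. X n \<omega> 1) \<in> borel_measurable M" for n
    using assms by (simp add: process_converges_weakly_def random_cadlag01_def)
  fix g :: "'b \<Rightarrow> real" assume g: "continuous_on UNIV g \<and> bounded (range g)"
  then obtain B where B: "\<And>y. \<bar>g y\<bar> \<le> B" by (auto simp: bounded_real)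
  have "skorokhod_continuous (\<lambda>f :: real \<Rightarrow> 'b. g (f 1))"
    unfolding skorokhod_continuous_def
  proof (intro allI impI)
    fix f :: "nat \<Rightarrow> real \<Rightarrow> 'b" and h
    assume "(\<forall>n. f n \<in> cadlag01) \<and> h \<in> cadlag01 \<and> skorokhod_tendsto f h"
    then obtain \<tau> :: "nat \<Rightarrow> real \<Rightarrow> real" where
      \<tau>: "\<And>n. strict_mono_on {0..1} (\<tau> n)" "\<And>n. \<tau> n ` {0..1} = {0..1}"
      and lim: "uniform_limit {0..1} (\<lambda>n t. f n (\<tau> n t)) h sequentially"
      unfolding skorokhod_tendsto_def by blast
    \<comment> \<open>An increasing map of [0,1] onto itself sends the largest point to the largest
      value.\<close>
    have "\<tau> n 1 = 1" for n
    proof -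
      obtain t where t: "t \<in> {0..1}" "\<tau> n t = 1"
        using \<tau>(2)[of n] by (metis atLeastAtMost_iff imageE order_refl zero_le_one)
      have "\<tau> n 1 \<in> {0..1}" using \<tau>(2)[of n] by auto
      moreover have "\<tau> n t \<le> \<tau> n 1"
        using t(1) strict_mono_on_leD[OF \<tau>(1), of t 1] by simp
      ultimately show ?thesis using t(2) by simp
    qed
    then have "(\<lambda>n. f n 1) \<longlonglongrightarrow> h 1"
      using tendsto_uniform_limitI[OF lim, of 1] by simp
    moreover have "isCont g (h 1)" using g by (simp add: continuous_on_eq_continuous_at)
    ultimately show "(\<lambda>n. g (f n 1)) \<longlonglongrightarrow> g (h 1)" by (rule isCont_tendsto_compose[rotated])
  qed
  then have "(\<lambda>n. \<integral>\<omega>. g (X n \<omega> 1) \<partial>M) \<longlonglongrightarrow> (\<integral>\<omega>. g (G \<omega> 1) \<partial>M')"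
    using assms B unfolding process_converges_weakly_def by blast
  moreover have "(\<integral>y. g y \<partial>distr M' borel (\<lambda>\<omega>. G \<omega> 1)) = (\<integral>\<omega>. g (G \<omega> 1) \<partial>M')"
    using assms g
    by (intro integral_distr)
      (auto simp: process_converges_weakly_def random_cadlag01_def intro: borel_measurable_continuous_onI)
  ultimately show "(\<lambda>n. \<integral>\<omega>. g (X n \<omega> 1) \<partial>M) \<longlonglongrightarrow> (\<integral>y. g y \<partial>distr M' borel (\<lambda>\<omega>. G \<omega> 1))" by simp
qed

text \<open>When proving \<open>P\<close>, a bound on \<open>X\<close> may be assumed: the level
  \<open>K\<close> is fixed first, and the event that \<open>norm (X n \<omega>)\<close> exceeds it
  takes half of the allowed failure probability.\<close>

lemma (in prob_space) with_high_prob_if_tight: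
  fixes X :: "nat \<Rightarrow> 'a \<Rightarrow> 'b::euclidean_space"
  assumes X: "converges_in_law M X \<mu>" and \<mu>: "prob_space \<mu>" "sets \<mu> = sets borel"
    and P: "\<And>K. 0 < K \<Longrightarrow> with_high_prob M (\<lambda>n \<omega>. norm (X n \<omega>) \<le> K \<longrightarrow> P n \<omega>)"
  shows "with_high_prob M P"
  unfolding with_high_prob_def
proof (intro allI impI)
  fix \<eta> :: real assume \<eta>: "0 < \<eta>"
  have [measurable]: "X n \<in> borel_measurable M" for n using X by (simp add: converges_in_law_def)
  obtain K where K: "0 < K" "\<forall>\<^sub>F n in sequentially. prob {\<omega> \<in> space M. K < norm (X n \<omega>)} \<le> \<eta> / 2"
    using converges_in_law_tight[OF X \<mu>, of "\<eta> / 2"] \<eta> by auto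
  have "\<forall>\<^sub>F n in sequentially. \<exists>A\<in>sets M. prob A \<le> \<eta> / 2 \<and>
      (\<forall>\<omega>\<in>space M - A. norm (X n \<omega>) \<le> K \<longrightarrow> P n \<omega>)"
    using \<eta> by (intro with_high_probD P K(1)) simp
  with K(2) show "\<forall>\<^sub>F n in sequentially. \<exists>A\<in>sets M. prob A \<le> \<eta> \<and> (\<forall>\<omega>\<in>space M - A. P n \<omega>)"
  proof eventually_elim
    case (elim n)
    then obtain A where A: "A \<in> sets M" "prob A \<le> \<eta> / 2"
      "\<forall>\<omega>\<in>space M - A. norm (X n \<omega>) \<le> K \<longrightarrow> P n \<omega>" by blast
    let ?C = "{\<omega> \<in> space M. K < norm (X n \<omega>)}"
    have C: "?C \<in> sets M" by measurable
    have "prob (A \<union> ?C) \<le> \<eta>"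
      using measure_Un_le[OF A(1) C] A(2) elim(1) by simp
    with A C show ?case by (intro bexI[of _ "A \<union> ?C"]) (auto simp: not_less)
  qed
qed

lemma converges_in_law_continuous_image:
  fixes h :: "'b::metric_space \<Rightarrow> 'd::metric_space"
  assumes X: "converges_in_law M X \<mu>" and \<mu>: "sets \<mu> = sets borel"
    and h: "continuous_on UNIV h"
  shows "converges_in_law M (\<lambda>n \<omega>. h (X n \<omega>)) (distr \<mu> borel h)"
  unfolding converges_in_law_def
proof (intro conjI allI impI)
  have hm: "h \<in> borel_measurable borel" using h by (rule borel_measurable_continuous_onI)
  show "(\<lambda>\<omega>. h (X n \<omega>)) \<in> borel_measurable M" for n
    by (rule measurable_compose[OF _ hm]) (use X in \<open>simp add: converges_in_law_def\<close>)
  fix g :: "'d \<Rightarrow> real" assume g: "continuous_on UNIV g \<and> bounded (range g)"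
  have "continuous_on UNIV (\<lambda>y. g (h y))"
    by (rule continuous_on_compose2[of UNIV g]) (use g h in auto)
  moreover have "bounded (range (\<lambda>y. g (h y)))"
    by (rule bounded_subset[of "range g"]) (use g in auto)
  moreover have "(\<integral>y. g y \<partial>distr \<mu> borel h) = (\<integral>y. g (h y) \<partial>\<mu>)"
    using g hm \<mu> by (intro integral_distr)
      (auto simp: measurable_cong_sets[OF \<mu> refl] intro: borel_measurable_continuous_onI)
  ultimately show "(\<lambda>n. \<integral>\<omega>. g (h (X n \<omega>)) \<partial>M) \<longlonglongrightarrow> (\<integral>y. g y \<partial>distr \<mu> borel h)"
    using conjunct2[OF X[unfolded converges_in_law_def], rule_format, of "\<lambda>y. g (h y)"] by simp
qed

section \<open>Linearization of the gradient, and matrix inverses\<close>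

text \<open>Mean value inequality on the convex ball for the gradient plus the linear map
  \<open>n *\<^sub>R (S b0 *v b)\<close>. The derivative is \<open>- n\<close> times the sum of two
  errors: the scaled Hessian against \<open>S\<close>, and \<open>S\<close> against its value at
  \<open>b0\<close>.\<close>

lemma gradient_linearization:
  fixes f :: "real ^ 'p \<Rightarrow> real" and S :: "real ^ 'p \<Rightarrow> real ^ 'p ^ 'p"
  assumes f: "smooth_concave f" and n: "0 < n" and b: "b \<in> cball b0 r"
    and H: "\<And>b. b \<in> cball b0 r \<Longrightarrow> spectral_norm (- (1 / n) *\<^sub>R hessian f b - S b) \<le> e1"
    and S: "\<And>b. b \<in> cball b0 r \<Longrightarrow> spectral_norm (S b - S b0) \<le> e2"
  shows "norm (gradient f b - gradient f b0 + n *\<^sub>R (S b0 *v (b - b0)))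
    \<le> n * (e1 + e2) * norm (b - b0)"
proof -
  let ?F = "\<lambda>b. gradient f b + n *\<^sub>R (S b0 *v b)"
  let ?D = "\<lambda>b v. hessian f b *v v + n *\<^sub>R (S b0 *v v)"
  have "(?F has_derivative ?D y) (at y within cball b0 r)" for y
    by (rule has_derivative_add[OF has_derivative_at_withinI[OF smooth_concave_hessian[OF f]]
          has_derivative_scaleR_right[OF bounded_linear_imp_has_derivative[OF
              matrix_vector_mul_bounded_linear]]])
  moreover have "onorm (?D y) \<le> n * (e1 + e2)" if y: "y \<in> cball b0 r" for y
  proof (rule onorm_bound)
    show "0 \<le> n * (e1 + e2)"
      using n order_trans[OF spectral_norm_nonneg H[OF y]] order_trans[OF spectral_norm_nonneg S[OF y]]
      by simp
    fix v :: "real ^ 'p"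
    have "?D y v = - n *\<^sub>R ((- (1 / n) *\<^sub>R hessian f y - S y) *v v + (S y - S b0) *v v)"
      unfolding matrix_vector_mult_diff_rdistrib scaleR_matrix_vector_assoc[symmetric]
      using n by (simp add: scaleR_diff_right scaleR_add_right)
    also have "norm \<dots> = n * norm ((- (1 / n) *\<^sub>R hessian f y - S y) *v v + (S y - S b0) *v v)"
      using n by simp
    also have "\<dots> \<le> n * (e1 * norm v + e2 * norm v)"
      using n by (intro mult_left_mono norm_triangle_mono
          order_trans[OF spectral_norm_bound] mult_right_mono H S y) auto
    finally show "norm (?D y v) \<le> n * (e1 + e2) * norm v" by (simp add: algebra_simps)
  qed
  moreover have "b0 \<in> cball b0 r" using b by (auto intro: order_trans[OF zero_le_dist])
  ultimately have "norm (?F b - ?F b0) \<le> n * (e1 + e2) * norm (b - b0)"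
    using b by (intro differentiable_bound[OF convex_cball]) auto
  then show ?thesis by (simp add: matrix_vector_mult_diff_distrib algebra_simps)
qed

lemma matrix_inv_mul:
  fixes A :: "real ^ 'p ^ 'p"
  assumes "invertible A"
  shows "A ** matrix_inv A = mat 1" "matrix_inv A ** A = mat 1"
  using someI_ex[OF assms[unfolded invertible_def]] unfolding matrix_inv_def
  by (rule conjunct1, rule conjunct2)

lemma matrix_inv_symmetric:
  fixes A :: "real ^ 'p ^ 'p"
  assumes A: "invertible A" and sym: "transpose A = A"
  shows "transpose (matrix_inv A) = matrix_inv A"
proof -
  have "transpose (matrix_inv A) ** A = mat 1"
    using arg_cong[OF matrix_inv_mul(1)[OF A], of transpose]
    by (simp add: matrix_transpose_mul sym transpose_mat)
  then have "transpose (matrix_inv A) ** (A ** matrix_inv A) = matrix_inv A"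
    by (simp add: matrix_mul_assoc)
  then show ?thesis by (simp add: matrix_inv_mul(1)[OF A])
qed

section \<open>Consistency and asymptotic normality of the estimator\<close>

theorem theorem2:
  fixes M :: "'a measure" and F :: "real \<Rightarrow> 'a measure"
    and I J :: "'v set"
    and N :: "real \<Rightarrow> 'v \<Rightarrow> 'v \<Rightarrow> 'a \<Rightarrow> nat"
    and lbar :: "real \<Rightarrow> 'v \<Rightarrow> 'a \<Rightarrow> real"
    and R :: "real \<Rightarrow> 'v \<Rightarrow> 'a \<Rightarrow> 'v set"
    and x :: "real \<Rightarrow> 'v \<Rightarrow> 'v \<Rightarrow> 'a \<Rightarrow> real ^ 'p"
    and \<beta>0 :: "real ^ 'p"
    and V :: "(real ^ 'p) set"
    and \<Sigma> :: "real \<Rightarrow> real ^ 'p \<Rightarrow> real ^ 'p ^ 'p"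
    and M' :: "'c measure" and G :: "'c \<Rightarrow> real \<Rightarrow> real ^ 'p"
    and \<beta>hat :: "nat \<Rightarrow> 'a \<Rightarrow> real ^ 'p"
  assumes "prob_space M" and "usual_conditions M F"
    and "counting_process M F I J N"
    and "\<forall>i\<in>I. predictable M F (\<lambda>t. lbar t i) \<and> (\<forall>t\<ge>0. \<forall>\<omega>\<in>space M. 0 \<le> lbar t i \<omega>)"
    and "\<forall>i\<in>I. (\<forall>t\<ge>0. \<forall>\<omega>\<in>space M. finite (R t i \<omega>) \<and> R t i \<omega> \<subseteq> J) \<and>
                (\<forall>j\<in>J. predictable M F (\<lambda>t \<omega>. indicator (R t i \<omega>) j :: real))"
    and "\<forall>i\<in>I. \<forall>j\<in>J. predictable M F (\<lambda>t. x t i j) \<and> locally_bounded M F (\<lambda>t. x t i j)"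
    and "has_intensity M F I J N
           (\<lambda>t i j \<omega>. lbar t i \<omega> * exp (\<beta>0 \<bullet> x t i j \<omega>) * indicator (R t i \<omega>) j)"
    and "open V" and "\<beta>0 \<in> V"
    and "converges_in_prob_on M V
           (\<lambda>n \<omega> \<beta>. - (1 / real n) *\<^sub>R
              hessian (log_PL I J N x R (event_time I J N n \<omega>) \<omega>) \<beta>)
           (\<Sigma> 1)"
    and "locally_lipschitz_on V (\<Sigma> 1)"
    and "\<exists>c>0. \<forall>\<beta>\<in>V. \<forall>k. is_eigenvalue (\<Sigma> 1 \<beta>) k \<longrightarrow> c \<le> k"
    and "gaussian_indep_increments M' G (\<lambda>\<alpha>. \<Sigma> \<alpha> \<beta>0)"
    and "process_converges_weakly M
           (\<lambda>n \<omega> \<alpha>. (1 / sqrt (real n)) *\<^sub>R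
              score I J N x R (event_time I J N (nat \<lfloor>\<alpha> * real n\<rfloor>) \<omega>) \<omega> \<beta>0)
           M' G"
    and "\<forall>n. \<beta>hat n \<in> borel_measurable M"
    and "AE \<omega> in M. \<forall>n.
           (\<exists>b. is_arg_max (log_PL I J N x R (event_time I J N n \<omega>) \<omega>) (\<lambda>_. True) b) \<longrightarrow>
           is_arg_max (log_PL I J N x R (event_time I J N n \<omega>) \<omega>) (\<lambda>_. True) (\<beta>hat n \<omega>)"
  shows "converges_in_prob M \<beta>hat \<beta>0 \<and>
         (\<exists>\<mu>. centered_gaussian (matrix_inv (\<Sigma> 1 \<beta>0)) \<mu> \<and>
              converges_in_law M (\<lambda>n \<omega>. sqrt (real n) *\<^sub>R (\<beta>hat n \<omega> - \<beta>0)) \<mu>)"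
proof -
  interpret prob_space M by fact
  define f where "f n \<omega> = log_PL I J N x R (event_time I J N n \<omega>) \<omega>" for n \<omega>
  define U where "U n \<omega> = gradient (f n \<omega>) \<beta>0" for n \<omega>
  define Z where "Z n \<omega> = (1 / sqrt (real n)) *\<^sub>R U n \<omega>" for n \<omega>
  define S where "S = \<Sigma> 1 \<beta>0"
  define \<nu> where "\<nu> = distr M' borel (\<lambda>\<omega>. G \<omega> 1)"
  have conc: "smooth_concave (f n \<omega>)" for n \<omega>
    unfolding f_def by (rule smooth_concave_log_PL)
  \<comment> \<open>The hypothesis constrains \<open>\<beta>hat\<close> only where a maximizer
    exists; existence is established inside \<open>key\<close>, with high probability.\<close>
  have argmax: "with_high_prob M (\<lambda>n \<omega>. (\<exists>b. is_arg_max (f n \<omega>) (\<lambda>_. True) b) \<longrightarrow>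
      is_arg_max (f n \<omega>) (\<lambda>_. True) (\<beta>hat n \<omega>))"
    unfolding f_def by (intro with_high_prob_AE) fact
  have gauss: "centered_gaussian S \<nu>"
    using \<open>gaussian_indep_increments M' G (\<lambda>\<alpha>. \<Sigma> \<alpha> \<beta>0)\<close>
    by (simp add: gaussian_indep_increments_def S_def \<nu>_def)
  \<comment> \<open>Symmetry of \<open>S\<close> comes from its being the covariance matrix of a
    Gaussian law.\<close>
  then have \<nu>: "prob_space \<nu>" "sets \<nu> = sets borel" and sym: "transpose S = S"
    by (auto simp: centered_gaussian_def)
  \<comment> \<open>At \<open>\<alpha> = 1\<close> the floor of \<open>\<alpha> * real n\<close> is
    \<open>n\<close> itself, so the endpoint of the score process is \<open>Z n\<close>.\<close>
  have Z: "converges_in_law M Z \<nu>"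
    using process_converges_weakly_endpoint[OF \<open>process_converges_weakly M _ M' G\<close>]
    by (simp add: \<nu>_def Z_def[abs_def] U_def f_def score_def)
  obtain c where c: "0 < c" "\<And>k. is_eigenvalue S k \<Longrightarrow> c \<le> k"
    using \<open>\<exists>c>0. \<forall>\<beta>\<in>V. \<forall>k. is_eigenvalue (\<Sigma> 1 \<beta>) k \<longrightarrow> c \<le> k\<close> \<open>\<beta>0 \<in> V\<close>
    unfolding S_def by blast
  have coer: "c * (norm v)\<^sup>2 \<le> v \<bullet> (S *v v)" for v
    by (rule eigenvalues_ge_imp_coercive[OF sym c(2)])
  have inv: "invertible S" by (rule coercive_imp_invertible[OF c(1) coer])
  obtain r0 L where r0: "0 < r0" and L: "\<And>b b'. \<lbrakk>b \<in> ball \<beta>0 r0 \<inter> V; b' \<in> ball \<beta>0 r0 \<inter> V\<rbrakk>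
      \<Longrightarrow> spectral_norm (\<Sigma> 1 b - \<Sigma> 1 b') \<le> L * dist b b'"
    using \<open>locally_lipschitz_on V (\<Sigma> 1)\<close> \<open>\<beta>0 \<in> V\<close> unfolding locally_lipschitz_on_def by blast
  obtain r1 where r1: "0 < r1" "ball \<beta>0 r1 \<subseteq> V"
    using \<open>open V\<close> \<open>\<beta>0 \<in> V\<close> by (auto simp: open_contains_ball)
  \<comment> \<open>Both conclusions are read off from this estimate: small \<open>\<rho>\<close>
    gives consistency, small \<open>e\<close> gives the limit law. The middle bound turns the
    linearization error into a multiple of the score.\<close>
  have key: "with_high_prob M (\<lambda>n \<omega>. 0 < n \<and> norm (\<beta>hat n \<omega> - \<beta>0) \<le> \<rho> \<and>
      norm (\<beta>hat n \<omega> - \<beta>0) \<le> 2 / (real n * c) * norm (U n \<omega>) \<and>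
      norm (real n *\<^sub>R (S *v (\<beta>hat n \<omega> - \<beta>0)) - U n \<omega>) \<le> real n * e * norm (\<beta>hat n \<omega> - \<beta>0))"
    if e: "0 < e" "e \<le> c / 2" and \<rho>: "0 < \<rho>" for e \<rho>
  proof -
    \<comment> \<open>\<open>q\<close> makes the Lipschitz error at most \<open>e / 2\<close>;
      \<open>\<bar>L\<bar> + 1\<close> is positive whatever the sign of \<open>L\<close>. Halving
      \<open>r0\<close> and \<open>r1\<close> puts the closed ball inside the open ones.\<close>
    define q where "q = e / (2 * (\<bar>L\<bar> + 1))"
    define r where "r = min (min \<rho> q) (min (r0 / 2) (r1 / 2))"
    have "0 < q" using e(1) by (simp add: q_def add_nonneg_pos)
    then have r: "0 < r" "r \<le> \<rho>" "r < r0" "r < r1" "r \<le> q"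
      using \<rho> r0 r1(1) unfolding r_def by linarith+
    have rV: "cball \<beta>0 r \<subseteq> V" "cball \<beta>0 r \<subseteq> ball \<beta>0 r0" using r1(2) r(3,4) by auto
    have rL: "spectral_norm (\<Sigma> 1 b - S) \<le> e / 2" if b: "b \<in> cball \<beta>0 r" for b
    proof -
      have "spectral_norm (\<Sigma> 1 b - S) \<le> L * dist b \<beta>0"
        using rV b \<open>\<beta>0 \<in> V\<close> r0 unfolding S_def by (intro L) auto
      also have "\<dots> \<le> (\<bar>L\<bar> + 1) * r"
        using b by (intro mult_mono) (auto simp: dist_commute)
      also have "\<dots> \<le> (\<bar>L\<bar> + 1) * q"
        using r(5) by (intro mult_left_mono) auto
      also have "\<dots> = e / 2" by (simp add: q_def divide_simps)
      finally show ?thesis .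
    qed
    let ?H = "\<lambda>n \<omega> \<beta>. spectral_norm (- (1 / real n) *\<^sub>R hessian (f n \<omega>) \<beta> - \<Sigma> 1 \<beta>)"
    have H: "with_high_prob M (\<lambda>n \<omega>. \<forall>\<beta>\<in>V. ?H n \<omega> \<beta> \<le> e / 2)"
      unfolding f_def using e(1)
      by (intro converges_in_prob_on_imp_with_high_prob[OF \<open>converges_in_prob_on M V _ (\<Sigma> 1)\<close>]) simp
    \<comment> \<open>\<open>U n\<close> is \<open>sqrt (real n)\<close> times the tight sequence
      \<open>Z n\<close>, while the threshold grows like \<open>n\<close>. On
      \<open>norm (Z n \<omega>) \<le> K\<close> the threshold wins once
      \<open>sqrt (real n)\<close> exceeds \<open>2 * K / (c * r)\<close>.\<close>
    have score_small: "with_high_prob M (\<lambda>n \<omega>. norm (U n \<omega>) < real n * c / 2 * r)"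
    proof (rule with_high_prob_if_tight[OF Z \<nu>])
      fix K :: real assume K: "0 < K"
      have "\<forall>\<^sub>F n in sequentially. 2 * K / (c * r) < sqrt (real n)"
        using filterlim_compose[OF sqrt_at_top filterlim_real_sequentially]
        by (simp add: filterlim_at_top_dense)
      then show "with_high_prob M (\<lambda>n \<omega>. norm (Z n \<omega>) \<le> K \<longrightarrow> norm (U n \<omega>) < real n * c / 2 * r)"
      proof (intro with_high_prob_eventually, eventually_elim, intro ballI impI)
        fix n \<omega> assume n: "2 * K / (c * r) < sqrt (real n)" and ZK: "norm (Z n \<omega>) \<le> K"
        have "0 < 2 * K / (c * r)" using K c(1) r(1) by simp
        with n have n0: "0 < sqrt (real n)" by linarith
        then have "norm (U n \<omega>) = sqrt (real n) * norm (Z n \<omega>)" by (simp add: Z_def)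
        also have "\<dots> \<le> sqrt (real n) * K" using ZK n0 by simp
        also have "K < sqrt (real n) * c / 2 * r"
          using n c(1) r(1) by (simp add: field_simps)
        then have "sqrt (real n) * K < sqrt (real n) * (sqrt (real n) * c / 2 * r)"
          using n0 by (rule mult_strict_left_mono)
        also have "\<dots> = real n * c / 2 * r"
          by (simp flip: mult.assoc)
        finally show "norm (U n \<omega>) < real n * c / 2 * r" .
      qed
    qed
    have "with_high_prob M (\<lambda>n \<omega>. (\<forall>\<beta>\<in>V. ?H n \<omega> \<beta> \<le> e / 2) \<and> norm (U n \<omega>) < real n * c / 2 * r \<and>
        ((\<exists>b. is_arg_max (f n \<omega>) (\<lambda>_. True) b) \<longrightarrow> is_arg_max (f n \<omega>) (\<lambda>_. True) (\<beta>hat n \<omega>)))"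
      by (intro with_high_prob_conj H score_small argmax)
    then show ?thesis
    proof (rule with_high_prob_mono, intro eventually_mono[OF eventually_gt_at_top[of 0]] ballI impI, elim conjE)
      fix n \<omega> assume n: "0 < n" and H: "\<forall>\<beta>\<in>V. ?H n \<omega> \<beta> \<le> e / 2"
        and small: "norm (U n \<omega>) < real n * c / 2 * r"
        and am: "(\<exists>b. is_arg_max (f n \<omega>) (\<lambda>_. True) b) \<longrightarrow> is_arg_max (f n \<omega>) (\<lambda>_. True) (\<beta>hat n \<omega>)"
      have lin: "\<forall>b\<in>cball \<beta>0 r. norm (gradient (f n \<omega>) b - gradient (f n \<omega>) \<beta>0 + real n *\<^sub>R (S *v (b - \<beta>0)))
          \<le> real n * e * norm (b - \<beta>0)"
      proof
        fix b assume b: "b \<in> cball \<beta>0 r"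
        have "spectral_norm (- (1 / real n) *\<^sub>R hessian (f n \<omega>) y - \<Sigma> 1 y) \<le> e / 2"
          if "y \<in> cball \<beta>0 r" for y using H rV(1) that by blast
        \<comment> \<open>The Hessian error and the Lipschitz error are at most \<open>e / 2\<close>
          each and add up to \<open>e\<close>.\<close>
        from gradient_linearization[OF conc _ b this rL[unfolded S_def]] n
        show "norm (gradient (f n \<omega>) b - gradient (f n \<omega>) \<beta>0 + real n *\<^sub>R (S *v (b - \<beta>0)))
            \<le> real n * e * norm (b - \<beta>0)" by (simp add: S_def)
      qed
      have coer': "real n * c * (norm v)\<^sup>2 \<le> v \<bullet> (real n *\<^sub>R (S *v v))" for v
        using mult_left_mono[OF coer[of v], of "real n"] by (simp add: mult.assoc)
      have bounds: "real n * e \<le> real n * c / 2" "0 < real n * c" using e n c(1) by auto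
      \<comment> \<open>The localization is applied with \<open>S\<close>, \<open>c\<close> and
        \<open>e\<close> all multiplied by \<open>n\<close>. Its first part supplies the existence
        of a maximizer that \<open>am\<close> asks for.\<close>
      note loc = concave_argmax_localization[OF conc r(1) bounds lin coer' small[unfolded U_def]]
      have "is_arg_max (f n \<omega>) (\<lambda>_. True) (\<beta>hat n \<omega>)" using am loc(1) by blast
      from loc(2-4)[OF this] r(2) n show "0 < n \<and> norm (\<beta>hat n \<omega> - \<beta>0) \<le> \<rho> \<and>
          norm (\<beta>hat n \<omega> - \<beta>0) \<le> 2 / (real n * c) * norm (U n \<omega>) \<and>
          norm (real n *\<^sub>R (S *v (\<beta>hat n \<omega> - \<beta>0)) - U n \<omega>) \<le> real n * e * norm (\<beta>hat n \<omega> - \<beta>0)"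
        by (auto simp: U_def)
    qed
  qed
  have meas [measurable]: "\<beta>hat n \<in> borel_measurable M" for n
    using \<open>\<forall>n. \<beta>hat n \<in> borel_measurable M\<close> by blast
  have consistent: "converges_in_prob M \<beta>hat \<beta>0"
  proof (rule converges_in_prob_if_with_high_prob)
    fix \<epsilon> :: real assume "0 < \<epsilon>"
    \<comment> \<open>The largest admissible \<open>e\<close> is taken, since only the bound by
      \<open>\<rho>\<close> is read off.\<close>
    with key[of "c / 2" \<epsilon>] c(1) show "with_high_prob M (\<lambda>n \<omega>. dist (\<beta>hat n \<omega>) \<beta>0 \<le> \<epsilon>)"
      by (auto elim!: with_high_prob_mono simp: dist_norm)
  qed (rule meas)
  define A where "A = matrix_inv S"
  define \<mu> where "\<mu> = distr \<nu> borel (\<lambda>y. A *v y)"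
  have AS: "A ** S = mat 1" using matrix_inv_mul[OF inv] by (simp add: A_def)
  \<comment> \<open>The sandwich covariance collapses because \<open>A\<close> inverts
    \<open>S\<close> and is itself symmetric.\<close>
  have "A ** S ** transpose A = A"
    using matrix_inv_symmetric[OF inv sym] by (simp add: AS) (simp add: A_def)
  with centered_gaussian_linear_image[OF gauss, of A]
  have gauss_\<mu>: "centered_gaussian A \<mu>" by (simp add: \<mu>_def)
  have AZ: "converges_in_law M (\<lambda>n \<omega>. A *v Z n \<omega>) \<mu>"
    unfolding \<mu>_def using Z \<nu>(2)
    by (rule converges_in_law_continuous_image)
      (intro linear_continuous_on matrix_vector_mul_bounded_linear)
  have \<mu>: "prob_space \<mu>" "sets \<mu> = sets borel"
    using gauss_\<mu> by (auto simp: centered_gaussian_def)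
  have "converges_in_law M (\<lambda>n \<omega>. sqrt (real n) *\<^sub>R (\<beta>hat n \<omega> - \<beta>0)) \<mu>"
  proof (rule slutsky[OF AZ \<mu>])
    show "(\<lambda>\<omega>. sqrt (real n) *\<^sub>R (\<beta>hat n \<omega> - \<beta>0)) \<in> borel_measurable M" for n by measurable
    fix \<epsilon> :: real assume \<epsilon>: "0 < \<epsilon>"
    show "with_high_prob M (\<lambda>n \<omega>. norm (sqrt (real n) *\<^sub>R (\<beta>hat n \<omega> - \<beta>0) - A *v Z n \<omega>) \<le> \<epsilon>)"
    proof (rule with_high_prob_if_tight[OF Z \<nu>])
      fix K :: real assume K: "0 < K"
      \<comment> \<open>Adding 1 makes \<open>B\<close> strictly positive, as the division in
        \<open>e\<close> requires.\<close>
      define B where "B = spectral_norm A + 1"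
      have B: "0 < B" "\<And>v. norm (A *v v) \<le> B * norm v"
        using spectral_norm_nonneg[of A] spectral_norm_bound[of A]
        by (auto simp: B_def algebra_simps intro: add_increasing order_trans)
      \<comment> \<open>The final error is at most \<open>B * (2 * e / c * K)\<close>, and the
        second term of the minimum brings this down to \<open>\<epsilon>\<close>.\<close>
      define e where "e = min (c / 2) (\<epsilon> * c / (2 * K * B))"
      have e: "0 < e" "e \<le> c / 2" "e \<le> \<epsilon> * c / (2 * K * B)"
        using \<epsilon> c(1) K B(1) by (auto simp: e_def)
      have eK: "B * (2 * e / c * K) \<le> \<epsilon>" using e(3) c(1) K B(1) by (simp add: field_simps)
      show "with_high_prob M (\<lambda>n \<omega>. norm (Z n \<omega>) \<le> K \<longrightarrow>
          norm (sqrt (real n) *\<^sub>R (\<beta>hat n \<omega> - \<beta>0) - A *v Z n \<omega>) \<le> \<epsilon>)"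
      \<comment> \<open>The radius in \<open>key\<close> is set to 1; the argument rests on the rate
        bound and on the linearization.\<close>
      proof (rule with_high_prob_mono[OF key[OF e(1,2) zero_less_one]],
          intro always_eventually allI ballI impI, elim conjE)
        fix n \<omega>
        define d where "d = \<beta>hat n \<omega> - \<beta>0"
        define s where "s = sqrt (real n)"
        assume n: "0 < n" and ZK: "norm (Z n \<omega>) \<le> K"
          and "norm (\<beta>hat n \<omega> - \<beta>0) \<le> 2 / (real n * c) * norm (U n \<omega>)"
          and "norm (real n *\<^sub>R (S *v (\<beta>hat n \<omega> - \<beta>0)) - U n \<omega>) \<le> real n * e * norm (\<beta>hat n \<omega> - \<beta>0)"
        moreover have s: "0 < s" "real n = s * s" using n by (auto simp: s_def)
        moreover have UZ: "U n \<omega> = s *\<^sub>R Z n \<omega>" using s(1) by (simp add: Z_def s_def)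
        ultimately have d: "norm d \<le> 2 / (s * s * c) * (s * norm (Z n \<omega>))"
          "norm ((s * s) *\<^sub>R (S *v d) - s *\<^sub>R Z n \<omega>) \<le> s * s * e * norm d"
          by (simp_all add: d_def)
        have "(s * s) *\<^sub>R (S *v d) - s *\<^sub>R Z n \<omega> = s *\<^sub>R (s *\<^sub>R (S *v d) - Z n \<omega>)"
          by (simp add: scaleR_diff_right)
        with d(2) s(1) have "s * norm (s *\<^sub>R (S *v d) - Z n \<omega>) \<le> s * (s * e * norm d)"
          by (simp add: mult.assoc)
        then have "norm (s *\<^sub>R (S *v d) - Z n \<omega>) \<le> s * e * norm d" using s(1) by simp
        \<comment> \<open>The rate bound on \<open>norm d\<close> is of order
          \<open>norm (Z n \<omega>) / s\<close>, which cancels the factor \<open>s\<close>.\<close>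
        also have "\<dots> \<le> s * e * (2 / (s * s * c) * (s * norm (Z n \<omega>)))"
          using s(1) e(1) by (intro mult_left_mono d(1)) auto
        also have "\<dots> = 2 * e / c * norm (Z n \<omega>)" using s(1) c(1) by (simp add: field_simps)
        also have "\<dots> \<le> 2 * e / c * K" using ZK e(1) c(1) by (intro mult_left_mono) auto
        finally have "norm (s *\<^sub>R (S *v d) - Z n \<omega>) \<le> 2 * e / c * K" .
        then have "B * norm (s *\<^sub>R (S *v d) - Z n \<omega>) \<le> \<epsilon>"
          using mult_left_mono[of _ "2 * e / c * K" B] B(1) eK by (meson less_imp_le order_trans)
        \<comment> \<open>Since \<open>A ** S = mat 1\<close>, the difference to be estimated is the
          image under \<open>A\<close> of the residual just bounded.\<close>
        moreover have "s *\<^sub>R d - A *v Z n \<omega> = A *v (s *\<^sub>R (S *v d) - Z n \<omega>)"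
          by (simp add: matrix_vector_mult_diff_distrib matrix_vector_mult_scaleR
              matrix_vector_mul_assoc AS)
        ultimately show "norm (sqrt (real n) *\<^sub>R (\<beta>hat n \<omega> - \<beta>0) - A *v Z n \<omega>) \<le> \<epsilon>"
          using B(2)[of "s *\<^sub>R (S *v d) - Z n \<omega>"] unfolding s_def[symmetric] d_def[symmetric] by simp
      qed
    qed
  qed
  with gauss_\<mu> have "\<exists>\<mu>. centered_gaussian (matrix_inv (\<Sigma> 1 \<beta>0)) \<mu> \<and>
      converges_in_law M (\<lambda>n \<omega>. sqrt (real n) *\<^sub>R (\<beta>hat n \<omega> - \<beta>0)) \<mu>"
    unfolding A_def S_def by blast
  with consistent show ?thesis by blast
qed

end
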